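(* There are constants such that the following holds. For any $n$ and $m$ with $n\le m\le n(n-1)$, there exists a directed graph $G$ with $n$ vertices and $m$ edges (and a source vertex $s$) such that every deterministic query/relaxation-based algorithm $\mathcal{A}$ that uses D-queries, weight queries and relaxation updates and correctly computes the distances from $s$ for every integer weight assignment on $G$ without negative cycles has worst-case running time $\Omega(nm/\log n)$. If moreover $m=\Omega(n^{1+\varepsilon})$ for some fixed $\varepsilon>0$, the lower bound improves to $\Omega(nm)$.
   Context: Model: given a directed graph $G=(V,E)$ with source $s$ and a weight assignment $\ell\colon E\to\mathbb{Z}$ with no negative cycles, each vertex $v$ carries a D-value $D[v]$, initialized to $D[s]=0$ and $D[v]=\ell_{sv}$ for $v\neq s$ with $(s,v)\in E$, and $D[v]=+\infty$ if $(s,v)\notin E$. A D-query is "$D[u]<D[v]$?" for vertices $u,v$; a weight query is "$\ell_{uv}<\ell_{xy}$?" for edges $(u,v),(x,y)\in E$; a relaxation update for an edge $(u,v)\in E$ performs $D[v]\leftarrow\min\{D[v],D[u]+\ell_{uv}\}$. A deterministic algorithm is a decision tree whose internal nodes are queries (with "yes"/"no" children) or relaxation updates (one child), and whose leaves are relaxation updates; each query or update is one step. The algorithm is correct if for every weight assignment, at the end $D[v]$ equals the distance from $s$ to $v$ for all $v$; its running time on $\ell$ is the number of steps until all D-values equal the correct distances, and the worst-case running time is the maximum over weight assignments. *)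

theory Defs
  imports "Graph_Theory.Graph_Theory" "HOL-Analysis.Analysis"
begin

text \<open>Weights are functions on all pairs; only their values on arcs are ever used.\<close>

type_synonym 'a weights = "'a \<times> 'a \<Rightarrow> int"
type_synonym 'a dvals = "'a \<Rightarrow> ereal"

definition no_negative_cycles :: "'a pair_pre_digraph \<Rightarrow> 'a weights \<Rightarrow> bool" where
  "no_negative_cycles G l \<longleftrightarrow>
     (\<forall>p. pre_digraph.cycle (with_proj G) p \<longrightarrow> 0 \<le> wf_digraph.awalk_cost (\<lambda>e. real_of_int (l e)) p)"

text \<open>The library function \<open>wf_digraph.\<mu>\<close> is the infimum of the walk costs, hence \<open>\<infinity>\<close> for
  unreachable vertices.\<close>

definition distance :: "'a pair_pre_digraph \<Rightarrow> 'a weights \<Rightarrow> 'a \<Rightarrow> 'a \<Rightarrow> ereal" where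
  "distance G l s v = wf_digraph.\<mu> (with_proj G) (\<lambda>e. real_of_int (l e)) s v"

definition init_dvals :: "'a pair_pre_digraph \<Rightarrow> 'a \<Rightarrow> 'a weights \<Rightarrow> 'a dvals" where
  "init_dvals G s l v =
     (if v = s then 0
      else if (s, v) \<in> parcs G then ereal (real_of_int (l (s, v)))
      else \<infinity>)"

definition relax :: "'a weights \<Rightarrow> 'a \<times> 'a \<Rightarrow> 'a dvals \<Rightarrow> 'a dvals" where
  "relax l e D = D(snd e := min (D (snd e)) (D (fst e) + ereal (real_of_int (l e))))"

text \<open>The two subtrees of a query are the continuations for the answers yes and no, in this
  order.\<close>

datatype 'a algorithm =
    D_Query 'a 'a "'a algorithm" "'a algorithm"
  | Weight_Query "'a \<times> 'a" "'a \<times> 'a" "'a algorithm" "'a algorithm"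
  | Relax "'a \<times> 'a" "'a algorithm"
  | Final_Relax "'a \<times> 'a"

primrec algorithm_on :: "'a pair_pre_digraph \<Rightarrow> 'a algorithm \<Rightarrow> bool" where
  "algorithm_on G (D_Query u v A B) \<longleftrightarrow>
     u \<in> pverts G \<and> v \<in> pverts G \<and> algorithm_on G A \<and> algorithm_on G B"
| "algorithm_on G (Weight_Query e f A B) \<longleftrightarrow>
     e \<in> parcs G \<and> f \<in> parcs G \<and> algorithm_on G A \<and> algorithm_on G B"
| "algorithm_on G (Relax e A) \<longleftrightarrow> e \<in> parcs G \<and> algorithm_on G A"
| "algorithm_on G (Final_Relax e) \<longleftrightarrow> e \<in> parcs G"

text \<open>The D-values along the computation: entry \<open>t\<close> of the list holds the D-values after
  \<open>t\<close> steps.\<close>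

primrec run :: "'a weights \<Rightarrow> 'a algorithm \<Rightarrow> 'a dvals \<Rightarrow> 'a dvals list" where
  "run l (D_Query u v A B) D = D # (if D u < D v then run l A D else run l B D)"
| "run l (Weight_Query e f A B) D = D # (if l e < l f then run l A D else run l B D)"
| "run l (Relax e A) D = D # run l A (relax l e D)"
| "run l (Final_Relax e) D = [D, relax l e D]"

definition dvals_correct :: "'a pair_pre_digraph \<Rightarrow> 'a \<Rightarrow> 'a weights \<Rightarrow> 'a dvals \<Rightarrow> bool" where
  "dvals_correct G s l D \<longleftrightarrow> (\<forall>v \<in> pverts G. D v = distance G l s v)"

definition correct_algorithm :: "'a pair_pre_digraph \<Rightarrow> 'a \<Rightarrow> 'a algorithm \<Rightarrow> bool" where
  "correct_algorithm G s A \<longleftrightarrow> algorithm_on G A \<and>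
     (\<forall>l. no_negative_cycles G l \<longrightarrow> dvals_correct G s l (last (run l A (init_dvals G s l))))"

definition running_time :: "'a pair_pre_digraph \<Rightarrow> 'a \<Rightarrow> 'a algorithm \<Rightarrow> 'a weights \<Rightarrow> nat" where
  "running_time G s A l =
     (LEAST t. t < length (run l A (init_dvals G s l)) \<and>
               dvals_correct G s l (run l A (init_dvals G s l) ! t))"

definition worst_case_time :: "'a pair_pre_digraph \<Rightarrow> 'a \<Rightarrow> 'a algorithm \<Rightarrow> nat" where
  "worst_case_time G s A = Max (running_time G s A ` {l. no_negative_cycles G l})"

text \<open>For correct algorithms the least element and the maximum above exist.\<close>

lemma length_run_le: "length (run l A D) \<le> size A + 2"
proof (induction A arbitrary: D)
  case (D_Query u v A B)
  show ?case using D_Query.IH(1)[of D] D_Query.IH(2)[of D] by simp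
next
  case (Weight_Query e f A B)
  show ?case using Weight_Query.IH(1)[of D] Weight_Query.IH(2)[of D]
    by (cases e; cases f) simp
next
  case (Relax e A)
  show ?case using Relax.IH[of "relax l e D"] by (cases e) simp
qed simp

lemma run_nonempty [simp]: "run l A D \<noteq> []"
  by (cases A) auto

lemma running_time_correct:
  assumes "correct_algorithm G s A" "no_negative_cycles G l"
  shows "running_time G s A l < length (run l A (init_dvals G s l))"
    and "dvals_correct G s l (run l A (init_dvals G s l) ! running_time G s A l)"
proof -
  let ?R = "run l A (init_dvals G s l)"
  have "length ?R - 1 < length ?R \<and> dvals_correct G s l (?R ! (length ?R - 1))"
    using assms by (simp add: correct_algorithm_def last_conv_nth)
  then have "running_time G s A l < length ?R \<and> dvals_correct G s l (?R ! running_time G s A l)"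
    unfolding running_time_def by (rule LeastI)
  then show "running_time G s A l < length ?R"
    and "dvals_correct G s l (?R ! running_time G s A l)" by auto
qed

lemma finite_running_times:
  assumes "correct_algorithm G s A"
  shows "finite (running_time G s A ` {l. no_negative_cycles G l})"
proof (rule finite_subset)
  show "running_time G s A ` {l. no_negative_cycles G l} \<subseteq> {..size A + 2}"
    using running_time_correct(1)[OF assms] length_run_le
    by (fastforce intro: less_imp_le order.strict_trans2)
qed simp

lemma no_negative_cycles_zero:
  assumes "pair_wf_digraph G"
  shows "no_negative_cycles G (\<lambda>_. 0)"
proof -
  interpret pair_wf_digraph G by fact
  have "sum_list (map (\<lambda>e. 0 :: real) p) = 0" for p :: "('a \<times> 'a) list"
    by (induction p) auto
  then show ?thesis
    by (simp add: no_negative_cycles_def awalk_cost_def)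
qed

end

theory Submission
  imports Defs
begin

text \<open>Take weights \<open>M (2\<^sup>v - 2\<^sup>u)\<close> on the arcs of a path from \<open>s\<close>, and one more than that on every other arc
  \<open>(u, v)\<close>. If \<open>M\<close> is large, then no query answer depends on the path, so the relaxations performed are
  those of a fixed sequence, which must contain the arcs of every path from \<open>s\<close> in this order.

  The graph consists of two parts of \<open>\<Theta>(k)\<close> levels each, with \<open>N\<close> vertices per level and out-degree
  at most \<open>d\<close>, where \<open>N k = \<Theta>(n)\<close>, \<open>d = \<Theta>(m / n)\<close> and \<open>k = \<Theta>(log n / log d)\<close>. A path makes passes
  through the levels; in pass \<open>i\<close> it zigzags through the first part (the bank) between the rows \<open>x\<^sub>i\<close>
  and \<open>y\<^sub>i\<close>, and the second part, a Benes network, then takes it from \<open>x\<^sub>i\<close> to \<open>x\<^bsub>i+1\<^esub>\<close>. As the Benes network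
  routes every permutation along disjoint paths, the pairs \<open>(x\<^sub>i, y\<^sub>i)\<close> can be chosen freely as
  long as no row is repeated. Since a block of at most \<open>N d k\<close> relaxations omits a bank arc of
  some unused pair, each of \<open>N / 4\<close> passes can be made to last for a whole block, which gives
  \<open>\<Omega>(N\<^sup>2 d k) = \<Omega>(n m / k)\<close> steps.\<close>

section \<open>Weights that make the algorithm oblivious\<close>

text \<open>The larger exponent dominates: if \<open>a <= b < d\<close>, then the left side is at
  most \<open>2 * 2^b <= 2^d\<close>, short of the right side. So the sorted exponents
  agree.\<close>

lemma sidon_powers_of_two:
  fixes a b c d :: nat
  assumes "(2::int)^a + 2^b = 2^c + 2^d"
  shows "a = c \<and> b = d \<or> a = d \<and> b = c"
proof -
  have less: "(2::int)^a + 2^b < 2^c + 2^d" if "a \<le> b" "b < d" for a b c d :: nat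
  proof -
    have "(2::int)^a \<le> 2^b" using that by (intro power_increasing) auto
    moreover have "(2::int) * 2^b \<le> 2^d"
      using that power_increasing[of "Suc b" d "2::int"] by simp
    moreover have "(0::int) < 2^c" by simp
    ultimately show ?thesis by linarith
  qed
  have ordered: "a = c \<and> b = d" if "a \<le> b" "c \<le> d" "(2::int)^a + 2^b = 2^c + 2^d" for a b c d :: nat
  proof -
    have "b = d" using less[of a b d c] less[of c d b a] that by (cases b d rule: linorder_cases) auto
    with that show ?thesis by simp
  qed
  show ?thesis
    using ordered[of a b c d] ordered[of b a c d] ordered[of a b d c] ordered[of b a d c] assms
    by (metis add.commute linear)
qed

text \<open>The multiple of \<open>M\<close> telescopes along a walk, so two walks with the same
  ends differ in cost only by how many arcs outside \<open>P\<close> they use.\<close>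

definition potential_weights :: "('a \<Rightarrow> int) \<Rightarrow> int \<Rightarrow> ('a \<times> 'a) set \<Rightarrow> 'a weights" where
  "potential_weights \<phi> M P e = M * (\<phi> (snd e) - \<phi> (fst e)) + (if e \<in> P then 0 else 1)"

text \<open>Since the \<open>\<phi>\<close>-differences along distinct arcs are distinct, the answers to all queries under
  \<open>potential_weights \<phi> M P\<close> depend neither on \<open>P\<close> nor on \<open>M\<close>, provided \<open>M\<close> is large. So the
  relaxations are those of a fixed sequence; \<open>F\<close> is the set of vertices with finite D-value.\<close>

primrec relaxation_trace :: "('a \<Rightarrow> int) \<Rightarrow> 'a algorithm \<Rightarrow> 'a set \<Rightarrow> ('a \<times> 'a) list list" where
  "relaxation_trace \<phi> (D_Query u v A B) F =
     [] # (if u \<in> F \<and> (v \<in> F \<longrightarrow> \<phi> u < \<phi> v) then relaxation_trace \<phi> A F else relaxation_trace \<phi> B F)"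
| "relaxation_trace \<phi> (Weight_Query e f A B) F =
     [] # (if \<phi> (snd e) - \<phi> (fst e) < \<phi> (snd f) - \<phi> (fst f) then relaxation_trace \<phi> A F else relaxation_trace \<phi> B F)"
| "relaxation_trace \<phi> (Relax e A) F = [e] # relaxation_trace \<phi> A (if fst e \<in> F then insert (snd e) F else F)"
| "relaxation_trace \<phi> (Final_Relax e) F = [[e]]"

text \<open>The offset \<open>d\<close> stands for the penalties collected so far. While its bound
  \<open>c\<close> stays below \<open>M\<close>, comparisons of D-values are decided by
  \<open>\<phi>\<close>.\<close>

definition near_potential ::
    "('a \<Rightarrow> int) \<Rightarrow> int \<Rightarrow> 'a \<Rightarrow> 'a set \<Rightarrow> int \<Rightarrow> 'a dvals \<Rightarrow> bool" where
  "near_potential \<phi> M s F c D \<longleftrightarrow>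
     (\<forall>v. v \<in> F \<longrightarrow> (\<exists>d. D v = ereal (real_of_int (M * (\<phi> v - \<phi> s) + d)) \<and> 0 \<le> d \<and> d \<le> c)) \<and>
     (\<forall>v. v \<notin> F \<longrightarrow> D v = \<infinity>)"

lemma near_potential_cases:
  assumes "near_potential \<phi> M s F c D"
  obtains "v \<notin> F" "D v = \<infinity>"
    | d where "v \<in> F" "D v = ereal (real_of_int (M * (\<phi> v - \<phi> s) + d))" "0 \<le> d" "d \<le> c"
  using assms unfolding near_potential_def by blast

text \<open>Potential differences add up along the relaxed arc and the penalty raises the offset by
  at most one; the minimum of two values of this form at one vertex has this form again.\<close>

lemma near_potential_relax:
  assumes "near_potential \<phi> M s F c D"
  shows "near_potential \<phi> M s (if fst e \<in> F then insert (snd e) F else F) (c + 1)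
           (relax (potential_weights \<phi> M P) e D)"
proof -
  obtain u w where e: "e = (u, w)" by (cases e)
  let ?l = "potential_weights \<phi> M P"
  let ?D' = "relax ?l e D" and ?F' = "if fst e \<in> F then insert (snd e) F else F"
  have weaken: "\<exists>d. D v = ereal (real_of_int (M * (\<phi> v - \<phi> s) + d)) \<and> 0 \<le> d \<and> d \<le> c + 1" if "v \<in> F" for v
    using assms that unfolding near_potential_def by (meson add_increasing2 order_trans zero_le_one)
  have inf: "D v = \<infinity>" if "v \<notin> F" for v
    using assms that unfolding near_potential_def by blast
  have other: "?D' v = D v" if "v \<noteq> w" for v using that by (simp add: relax_def e)
  have at: "?D' w = min (D w) (D u + ereal (real_of_int (?l (u, w))))" by (simp add: relax_def e)
  have head: "(w \<in> ?F' \<longrightarrow> (\<exists>d. ?D' w = ereal (real_of_int (M * (\<phi> w - \<phi> s) + d)) \<and> 0 \<le> d \<and> d \<le> c + 1)) \<and>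
     (w \<notin> ?F' \<longrightarrow> ?D' w = \<infinity>)"
  proof (cases "u \<in> F")
    case False
    then show ?thesis using weaken[of w] inf[of u] inf[of w] at by (auto simp: e)
  next
    case True
    then obtain d where d: "D u = ereal (real_of_int (M * (\<phi> u - \<phi> s) + d))" "0 \<le> d" "d \<le> c"
      using assms unfolding near_potential_def by blast
    define d' where "d' = d + (if (u, w) \<in> P then 0 else 1)"
    have sum: "D u + ereal (real_of_int (?l (u, w))) = ereal (real_of_int (M * (\<phi> w - \<phi> s) + d'))"
      by (simp add: d potential_weights_def d'_def algebra_simps)
    have d': "0 \<le> d'" "d' \<le> c + 1" using d by (auto simp: d'_def)
    show ?thesis
    proof (cases "w \<in> F")
      case False
      then show ?thesis using at sum d' inf[of w] True by (auto simp: e)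
    next
      case wF: True
      obtain d2 where d2: "D w = ereal (real_of_int (M * (\<phi> w - \<phi> s) + d2))" "0 \<le> d2" "d2 \<le> c + 1"
        using weaken[OF wF] by blast
      have "?D' w = ereal (real_of_int (M * (\<phi> w - \<phi> s) + min d2 d'))"
        unfolding at sum d2(1) by (auto simp: min_def)
      then show ?thesis using d2 d' True by (auto simp: e min_def)
    qed
  qed
  show ?thesis
    unfolding near_potential_def
  proof (intro conjI allI impI)
    fix v assume v: "v \<in> ?F'"
    show "\<exists>d. ?D' v = ereal (real_of_int (M * (\<phi> v - \<phi> s) + d)) \<and> 0 \<le> d \<and> d \<le> c + 1"
    proof (cases "v = w")
      case True then show ?thesis using head v by blast
    next
      case False
      then have "v \<in> F" using v by (auto simp: e split: if_splits)
      then show ?thesis using weaken[of v] other[OF False] by simp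
    qed
  next
    fix v assume v: "v \<notin> ?F'"
    show "?D' v = \<infinity>"
    proof (cases "v = w")
      case True then show ?thesis using head v by blast
    next
      case False
      then show ?thesis using v inf[of v] other[of v] by (auto split: if_splits)
    qed
  qed
qed

text \<open>Distinct integers differ by at least 1, so their multiples differ by at least
  \<open>M\<close>, more than the offsets can make up for.\<close>

lemma scaled_less_iff:
  fixes M a b x y :: int
  assumes "x \<noteq> y" "0 \<le> a" "a < M" "0 \<le> b" "b < M"
  shows "M * x + a < M * y + b \<longleftrightarrow> x < y"
proof -
  have *: "M * x + a < M * y + b" if "x < y" "a < M" "0 \<le> a" "0 \<le> b" for x y a b
  proof -
    have "M * (x + 1) \<le> M * y" using that by (intro mult_left_mono) auto
    then show ?thesis using that by (simp add: algebra_simps)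
  qed
  show ?thesis using *[of x y a b] *[of y x b a] assms by (cases x y rule: linorder_cases) auto
qed

text \<open>Differences along distinct arcs are distinct and nonzero, so no query about two vertices
  or two arcs is a tie that the penalties could decide.\<close>

locale sidon_potential =
  fixes \<phi> :: "'a \<Rightarrow> int"
  assumes sidon: "u \<noteq> v \<Longrightarrow> \<phi> v - \<phi> u = \<phi> y - \<phi> x \<Longrightarrow> u = x \<and> v = y"
begin

lemma potential_neq: "u \<noteq> v \<Longrightarrow> \<phi> u \<noteq> \<phi> v"
  \<comment> \<open>With equal potentials the difference along \<open>(u, v)\<close> would be 0, as
    it is for \<open>(u, u)\<close>.\<close>
  using sidon[of u v u v] sidon[of u v u u] by auto

lemma D_query_answer:
  assumes "near_potential \<phi> M s F c D" "c < M"
  shows "D u < D v \<longleftrightarrow> u \<in> F \<and> (v \<in> F \<longrightarrow> \<phi> u < \<phi> v)"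
proof (cases "u = v")
  case False
  then have "\<phi> u - \<phi> s \<noteq> \<phi> v - \<phi> s" using potential_neq[of u v] by auto
  from scaled_less_iff[OF this, of _ M]
  have "\<And>a b. \<lbrakk>0 \<le> a; a \<le> c; 0 \<le> b; b \<le> c\<rbrakk> \<Longrightarrow>
      M * (\<phi> u - \<phi> s) + a < M * (\<phi> v - \<phi> s) + b \<longleftrightarrow> \<phi> u < \<phi> v"
    using assms(2) by auto
  note iff = this
  show ?thesis
  proof (cases rule: near_potential_cases[OF assms(1), where v = u])
    case 1
    then show ?thesis by simp
  next
    case u: (2 a)
    show ?thesis
    proof (cases rule: near_potential_cases[OF assms(1), where v = v])
      case 1
      then show ?thesis using u by simp
    next
      case v: (2 b)
      have "D u < D v \<longleftrightarrow> M * (\<phi> u - \<phi> s) + a < M * (\<phi> v - \<phi> s) + b"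
        unfolding u(2) v(2) less_ereal.simps of_int_less_iff ..
      then show ?thesis using iff[of a b] u v by auto
    qed
  qed
qed auto

lemma weight_query_answer:
  assumes "fst e \<noteq> snd e" "2 \<le> M"
  shows "potential_weights \<phi> M P e < potential_weights \<phi> M P f \<longleftrightarrow>
     \<phi> (snd e) - \<phi> (fst e) < \<phi> (snd f) - \<phi> (fst f)"
proof (cases "e = f")
  case False
  then have "\<phi> (snd e) - \<phi> (fst e) \<noteq> \<phi> (snd f) - \<phi> (fst f)"
    using sidon[OF assms(1)] by (metis prod_eqI)
  then show ?thesis
    unfolding potential_weights_def using assms(2) by (intro scaled_less_iff) auto
qed auto

text \<open>The slack \<open>c + int (size A) < M\<close> survives the induction because a
  relaxation raises \<open>c\<close> by one while the remaining tree shrinks. Together with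
  \<open>1 <= c\<close> it gives \<open>2 <= M\<close>, which weight queries require.\<close>

lemma run_potential_weights:
  fixes M P defines "l \<equiv> potential_weights \<phi> M P"
  assumes "pair_digraph G" "algorithm_on G A" "near_potential \<phi> M s F c D" "1 \<le> c" "c + int (size A) < M"
  shows "length (run l A D) = Suc (length (relaxation_trace \<phi> A F)) \<and>
     (\<forall>t \<le> length (relaxation_trace \<phi> A F). run l A D ! t = fold (relax l) (concat (take t (relaxation_trace \<phi> A F))) D)"
  using assms(3-)
proof (induction A arbitrary: F c D)
  case (D_Query u v A B)
  have "D u < D v \<longleftrightarrow> u \<in> F \<and> (v \<in> F \<longrightarrow> \<phi> u < \<phi> v)"
    using D_query_answer[OF D_Query.prems(2)] D_Query.prems(4) by auto
  then show ?case
    using D_Query.IH(1)[of F c D] D_Query.IH(2)[of F c D] D_Query.prems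
    by (auto simp: nth_Cons take_Cons split: nat.splits)
next
  case (Weight_Query e f A B)
  have "fst e \<noteq> snd e"
    using pair_loopfree_digraph.pair_no_loops[of G e] assms(2) Weight_Query.prems(1)
    by (simp add: pair_digraph_def)
  then have "l e < l f \<longleftrightarrow> \<phi> (snd e) - \<phi> (fst e) < \<phi> (snd f) - \<phi> (fst f)"
    unfolding l_def using Weight_Query.prems by (intro weight_query_answer) auto
  then show ?case
    using Weight_Query.IH(1)[of F c D] Weight_Query.IH(2)[of F c D] Weight_Query.prems
    by (auto simp: nth_Cons take_Cons split: nat.splits)
next
  case (Relax e A)
  show ?case
    using Relax.IH[OF _ near_potential_relax[OF Relax.prems(2), where e = e and P = P, folded l_def]] Relax.prems
    by (cases e) (auto simp: nth_Cons take_Cons split: nat.splits)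
next
  case (Final_Relax e)
  show ?case by (auto simp: nth_Cons take_Cons split: nat.splits)
qed

end

section \<open>Tight D-values and the order of relaxations\<close>

lemma init_dvals_near_potential:
  assumes "P \<subseteq> parcs G"
  shows "near_potential \<phi> M s ({s} \<union> {v. (s, v) \<in> parcs G}) 1
           (init_dvals G s (potential_weights \<phi> M P))"
  unfolding near_potential_def init_dvals_def potential_weights_def
  by (auto intro: exI[of _ 0] exI[of _ 1])

definition path_arcs :: "'a \<Rightarrow> (nat \<Rightarrow> 'a) \<Rightarrow> nat \<Rightarrow> ('a \<times> 'a) set" where
  "path_arcs s v r = insert (s, v 0) ((\<lambda>a. (v a, v (Suc a))) ` {..<r})"

definition path_from :: "('a \<times> 'a) set \<Rightarrow> 'a \<Rightarrow> (nat \<Rightarrow> 'a) \<Rightarrow> nat \<Rightarrow> bool" where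
  "path_from E s v r \<longleftrightarrow> inj_on v {..r} \<and> s \<notin> v ` {..r} \<and> path_arcs s v r \<subseteq> E"

text \<open>The arc from \<open>s\<close> to \<open>v 0\<close> does not occur here: the initial
  D-values already account for it, so it need not be relaxed.\<close>

definition arcs_embed :: "(nat \<Rightarrow> 'a) \<Rightarrow> nat \<Rightarrow> ('a \<times> 'a) list \<Rightarrow> bool" where
  "arcs_embed v r es \<longleftrightarrow> (\<exists>h. strict_mono_on {..<r} h \<and>
     (\<forall>a<r. h a < length es \<and> es ! h a = (v a, v (Suc a))))"

lemma arcs_embed_0 [simp]: "arcs_embed v 0 es"
  by (simp add: arcs_embed_def strict_mono_on_def)

lemma arcs_embed_append: "arcs_embed v r es \<Longrightarrow> arcs_embed v r (es @ fs)"
  unfolding arcs_embed_def by (force simp: nth_append)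

lemma arcs_embed_snoc:
  assumes "arcs_embed v r es"
  shows "arcs_embed v (Suc r) (es @ [(v r, v (Suc r))])"
proof -
  obtain h where h: "strict_mono_on {..<r} h" "\<forall>a<r. h a < length es \<and> es ! h a = (v a, v (Suc a))"
    using assms unfolding arcs_embed_def by blast
  have "strict_mono_on {..<Suc r} (h(r := length es))"
    using h by (auto simp: strict_mono_on_def less_Suc_eq)
  then show ?thesis unfolding arcs_embed_def
    using h(2) by (intro exI[of _ "h(r := length es)"]) (auto simp: nth_append less_Suc_eq)
qed

text \<open>A D-value equal to the bare potential has collected no penalty. Unless it was there
  initially, it comes from relaxing a path arc whose tail was already tight; tracing this back to
  \<open>v 0\<close> gives the embedding.\<close>

lemma tight_imp_embedded:
  fixes \<phi> :: "'a \<Rightarrow> int" and M :: int and v :: "nat \<Rightarrow> 'a" and s r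
  defines "l \<equiv> potential_weights \<phi> M (path_arcs s v r)"
  assumes path: "path_from (parcs G) s v r"
  shows "(\<exists>F c. near_potential \<phi> M s F c (fold (relax l) es (init_dvals G s l))) \<and>
    (\<forall>x. fold (relax l) es (init_dvals G s l) x = ereal (real_of_int (M * (\<phi> x - \<phi> s))) \<longrightarrow>
       x = s \<or> (\<exists>i\<le>r. x = v i \<and> arcs_embed v i es))"
proof (induction es rule: rev_induct)
  case Nil
  have sub: "path_arcs s v r \<subseteq> parcs G" and s: "s \<notin> v ` {..r}" using path by (auto simp: path_from_def)
  have "x = s \<or> x = v 0" if "init_dvals G s l x = ereal (real_of_int (M * (\<phi> x - \<phi> s)))" for x
  proof (rule ccontr)
    assume neg: "\<not> (x = s \<or> x = v 0)"
    then have "(s, x) \<notin> path_arcs s v r" using s by (auto simp: path_arcs_def)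
    with neg that show False
      by (auto simp: init_dvals_def l_def potential_weights_def split: if_splits)
  qed
  then show ?case using init_dvals_near_potential[OF sub] unfolding l_def by fastforce
next
  case (snoc e es)
  define D where "D = fold (relax l) es (init_dvals G s l)"
  obtain u w where e: "e = (u, w)" by (cases e)
  obtain F c where near: "near_potential \<phi> M s F c D" using snoc unfolding D_def by blast
  have tight: "x = s \<or> (\<exists>i\<le>r. x = v i \<and> arcs_embed v i es)"
    if "D x = ereal (real_of_int (M * (\<phi> x - \<phi> s)))" for x
    using snoc that unfolding D_def by blast
  have inj: "inj_on v {..r}" and s: "s \<notin> v ` {..r}" using path by (auto simp: path_from_def)
  have "x = s \<or> (\<exists>i\<le>r. x = v i \<and> arcs_embed v i (es @ [e]))"
    if x: "relax l e D x = ereal (real_of_int (M * (\<phi> x - \<phi> s)))" for x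
  proof (cases "D x = ereal (real_of_int (M * (\<phi> x - \<phi> s)))")
    case True
    then show ?thesis using tight[of x] arcs_embed_append by metis
  next
    case False
    \<comment> \<open>Only the head of the relaxed arc changes, so a newly tight vertex is
      \<open>w\<close> and its value comes from \<open>u\<close>.\<close>
    then have xw: "x = w" using x by (auto simp: relax_def e split: if_splits)
    have sum: "D u + ereal (real_of_int (l (u, w))) = ereal (real_of_int (M * (\<phi> w - \<phi> s)))"
      using x False xw by (auto simp: relax_def e min_def split: if_splits)
    obtain d where d: "D u = ereal (real_of_int (M * (\<phi> u - \<phi> s) + d))" "0 \<le> d"
      using near_potential_cases[OF near, of u] sum by (metis plus_ereal.simps(2) PInfty_neq_ereal(1))
    have "M * (\<phi> u - \<phi> s) + d + l (u, w) = M * (\<phi> w - \<phi> s)"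
      using sum unfolding d(1) plus_ereal.simps ereal.inject of_int_add[symmetric] of_int_eq_iff .
    \<comment> \<open>After cancelling potentials, the offset at \<open>u\<close> and the penalty of
      the arc sum to 0; both are nonnegative, so both vanish.\<close>
    then have "d + (if (u, w) \<in> path_arcs s v r then 0 else 1) = 0"
      by (simp add: l_def potential_weights_def algebra_simps)
    then have d0: "d = 0" and uw: "(u, w) \<in> path_arcs s v r" using d(2) by (auto split: if_splits)
    consider "w = v 0" | a where "a < r" "u = v a" "w = v (Suc a)"
      using uw unfolding path_arcs_def by blast
    then show ?thesis
    proof cases
      case 1 then show ?thesis using xw by auto
    next
      case (2 a)
      obtain i where i: "i \<le> r" "u = v i" "arcs_embed v i es"
        using tight[of u] d(1) d0 2 s by auto
      then have "i = a" using inj 2 by (auto simp: inj_on_def)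
      then show ?thesis using i 2 arcs_embed_snoc[of v a es] xw e by (intro disjI2 exI[of _ "Suc a"]) auto
    qed
  qed
  moreover have "\<exists>F c. near_potential \<phi> M s F c (relax l e D)"
    using near_potential_relax[OF near] unfolding l_def by blast
  ultimately show ?case by (simp add: D_def)
qed

section \<open>Walk costs and the common relaxation sequence\<close>

lemma awalk_cost_potential_weights:
  assumes "pair_wf_digraph G" "pre_digraph.awalk (with_proj G) u p w"
  shows "wf_digraph.awalk_cost (\<lambda>e. real_of_int (potential_weights \<phi> M P e)) p
     = real_of_int (M * (\<phi> w - \<phi> u)) + real (length (filter (\<lambda>e. e \<notin> P) p))"
proof -
  interpret pair_wf_digraph G by fact
  show ?thesis using assms(2)
    by (induction p arbitrary: u)
      (auto simp: awalk_Cons_iff awalk_Nil_iff potential_weights_def algebra_simps)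
qed

lemma potential_weights_no_negative_cycles:
  assumes "pair_wf_digraph G"
  shows "no_negative_cycles G (potential_weights \<phi> M P)"
proof -
  interpret pair_wf_digraph G by fact
  show ?thesis unfolding no_negative_cycles_def
    using awalk_cost_potential_weights[OF assms] by (auto simp: cycle_def)
qed

text \<open>The path itself is a walk without penalised arcs. An upper bound suffices, since
  \<open>near_potential\<close> bounds the D-values from below.\<close>

lemma distance_path_end:
  assumes wf: "pair_wf_digraph G" and path: "path_from (parcs G) s v r"
  shows "distance G (potential_weights \<phi> M (path_arcs s v r)) s (v r)
    \<le> ereal (real_of_int (M * (\<phi> (v r) - \<phi> s)))"
proof -
  interpret pair_wf_digraph G by fact
  define p where "p = (s, v 0) # map (\<lambda>a. (v a, v (Suc a))) [0..<r]"
  have arcs: "path_arcs s v r \<subseteq> parcs G" using path by (simp add: path_from_def)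
  have tail: "awalk (v 0) (map (\<lambda>a. (v a, v (Suc a))) [0..<i]) (v i)" if "i \<le> r" for i
    using that
  proof (induction i)
    case 0
    have "(s, v 0) \<in> parcs G" using arcs by (auto simp: path_arcs_def)
    then show ?case by (auto simp: awalk_Nil_iff dest: wellformed')
  next
    case (Suc i)
    have "(v i, v (Suc i)) \<in> parcs G" using arcs Suc.prems by (auto simp: path_arcs_def)
    then show ?case using Suc by (auto simp: awalk_simps dest: wellformed')
  qed
  have "(s, v 0) \<in> parcs G" using arcs by (auto simp: path_arcs_def)
  then have walk: "awalk s p (v r)"
    using tail[of r] by (auto simp: p_def awalk_Cons_iff dest: wellformed')
  have "set p \<subseteq> path_arcs s v r" by (auto simp: p_def path_arcs_def)
  then have "filter (\<lambda>e. e \<notin> path_arcs s v r) p = []" by (auto simp: filter_empty_conv)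
  then have "awalk_cost (\<lambda>e. real_of_int (potential_weights \<phi> M (path_arcs s v r) e)) p
      = real_of_int (M * (\<phi> (v r) - \<phi> s))"
    using awalk_cost_potential_weights[OF wf walk] by simp
  then show ?thesis unfolding distance_def using min_cost_le_walk_cost[OF walk] by metis
qed

lemma length_concat_take_relaxation_trace: "length (concat (take t (relaxation_trace \<phi> A F))) \<le> t"
proof (induction A arbitrary: F t)
qed (auto simp: take_Cons le_SucI split: nat.splits)

text \<open>Once the D-values are correct for the weights of a path, its end is tight, so the
  relaxations so far contain the path. For all paths these are prefixes of one trace, cut off at the
  worst-case time.\<close>

lemma worst_case_relaxation_sequence:
  fixes G :: "nat pair_pre_digraph"
  assumes G: "pair_digraph G" and A: "correct_algorithm G s A"
  shows "\<exists>\<tau>. length \<tau> \<le> worst_case_time G s A \<and>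
    (\<forall>v r. path_from (parcs G) s v r \<longrightarrow> arcs_embed v r \<tau>)"
proof -
  define \<phi> where "\<phi> = (\<lambda>v::nat. (2::int)^v)"
  interpret sidon_potential \<phi>
  proof
    fix u v x y :: nat assume "u \<noteq> v" "\<phi> v - \<phi> u = \<phi> y - \<phi> x"
    then show "u = x \<and> v = y"
      using sidon_powers_of_two[of v x y u] by (auto simp: \<phi>_def)
  qed
  have wf: "pair_wf_digraph G" using G by (simp add: pair_digraph.pair_wf_digraph)
  define F where "F = {s} \<union> {v. (s, v) \<in> parcs G}"
  define W where "W = worst_case_time G s A"
  \<comment> \<open>Initial offsets are at most 1 and each relaxation adds at most 1, so
    \<open>1 + int (size A) < M\<close> is what is required.\<close>
  define M where "M = int (size A) + 2"
  define \<tau> where "\<tau> = concat (take W (relaxation_trace \<phi> A F))"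
  have "arcs_embed v r \<tau>" if path: "path_from (parcs G) s v r" for v r
  proof -
    define l where "l = potential_weights \<phi> M (path_arcs s v r)"
    define t where "t = running_time G s A l"
    let ?R = "run l A (init_dvals G s l)"
    have nn: "no_negative_cycles G l"
      unfolding l_def by (rule potential_weights_no_negative_cycles[OF wf])
    have tW: "t \<le> W"
      unfolding t_def W_def worst_case_time_def using finite_running_times[OF A] nn by (intro Max_ge) auto
    have arcs: "path_arcs s v r \<subseteq> parcs G" and ends: "s \<notin> v ` {..r}"
      using path by (simp_all add: path_from_def)
    have run: "length ?R = Suc (length (relaxation_trace \<phi> A F)) \<and>
        (\<forall>t\<le>length (relaxation_trace \<phi> A F). ?R ! t = fold (relax l) (concat (take t (relaxation_trace \<phi> A F))) (init_dvals G s l))"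
      unfolding l_def F_def
      using run_potential_weights[OF G _ init_dvals_near_potential[OF arcs]] A
      by (auto simp: correct_algorithm_def M_def)
    have t: "t < length ?R" "dvals_correct G s l (?R ! t)"
      unfolding t_def using running_time_correct[OF A nn] by auto
    define es where "es = concat (take t (relaxation_trace \<phi> A F))"
    have Rt: "?R ! t = fold (relax l) es (init_dvals G s l)" using run t(1) by (auto simp: es_def)
    have vr: "v r \<in> pverts G"
    proof (cases r)
      case 0
      then show ?thesis using arcs pair_wf_digraph.in_arcsD2[OF wf] by (auto simp: path_arcs_def)
    next
      case (Suc a)
      then show ?thesis using arcs pair_wf_digraph.in_arcsD2[OF wf, of "v a" "v (Suc a)"] by (auto simp: path_arcs_def)
    qed
    have le: "(?R ! t) (v r) \<le> ereal (real_of_int (M * (\<phi> (v r) - \<phi> s)))"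
      using t(2) vr distance_path_end[OF wf path] unfolding dvals_correct_def l_def by auto
    note tight = tight_imp_embedded[OF path, of \<phi> M es, folded l_def, folded Rt]
    obtain F' c where "near_potential \<phi> M s F' c (?R ! t)" using tight by blast
    \<comment> \<open>The upper bound makes the value finite and forces its nonnegative offset to be
      0.\<close>
    then have "(?R ! t) (v r) = ereal (real_of_int (M * (\<phi> (v r) - \<phi> s)))"
      using le by (cases rule: near_potential_cases[where v = "v r"]) auto
    then have "v r = s \<or> (\<exists>i\<le>r. v r = v i \<and> arcs_embed v i es)" using tight by blast
    moreover have "v r \<noteq> s" using ends by auto
    ultimately obtain i where i: "i \<le> r" "v r = v i" "arcs_embed v i es" by blast
    then have "i = r" using path by (auto simp: path_from_def inj_on_def)
    moreover have "\<tau> = es @ concat (take (W - t) (drop t (relaxation_trace \<phi> A F)))"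
      using tW by (simp add: \<tau>_def es_def flip: concat_append take_add)
    ultimately show ?thesis using i(3) arcs_embed_append by metis
  qed
  then show ?thesis
    unfolding W_def[symmetric] using length_concat_take_relaxation_trace[of W \<phi> A F] by (auto simp: \<tau>_def)
qed

section \<open>Routing permutations\<close>

text \<open>The induction removes an \<open>a\<close>-pair \<open>x, y\<close> and lets \<open>b\<close> match the former \<open>b\<close>-partners of
  \<open>x\<close> and \<open>y\<close> with each other.\<close>

lemma two_involutions_coloring:
  fixes a b :: "'a \<Rightarrow> 'a"
  assumes "finite X"
    and "\<And>x. x \<in> X \<Longrightarrow> a x \<in> X \<and> a (a x) = x \<and> a x \<noteq> x"
    and "\<And>x. x \<in> X \<Longrightarrow> b x \<in> X \<and> b (b x) = x \<and> b x \<noteq> x"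
  shows "\<exists>c :: 'a \<Rightarrow> bool. \<forall>x\<in>X. c (a x) \<noteq> c x \<and> c (b x) \<noteq> c x"
  using assms
proof (induction X arbitrary: b rule: finite_psubset_induct)
  case (psubset X)
  note a = psubset.prems(1) and b = psubset.prems(2)
  show ?case
  proof (cases "X = {}")
    case False
    then obtain x where x: "x \<in> X" by blast
    define y where "y = a x"
    have y: "y \<in> X" "a y = x" "y \<noteq> x" using a[OF x] by (auto simp: y_def)
    define X' where "X' = X - {x, y}"
    have X': "X' \<subset> X" using x by (auto simp: X'_def)
    have a': "a z \<in> X' \<and> a (a z) = z \<and> a z \<noteq> z" if "z \<in> X'" for z
      using a[of z] that y unfolding X'_def y_def by auto
    show ?thesis
    proof (cases "b x = y")
      case True
      then have by_x: "b y = x" using b[OF x] by auto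
      have b': "b z \<in> X' \<and> b (b z) = z \<and> b z \<noteq> z" if "z \<in> X'" for z
        using b[of z] that True by_x unfolding X'_def by auto
      have "\<exists>c :: 'a \<Rightarrow> bool. \<forall>z\<in>X'. c (a z) \<noteq> c z \<and> c (b z) \<noteq> c z" by (rule psubset.IH[OF X']) (erule a', erule b')
      then obtain c :: "'a \<Rightarrow> bool" where c: "\<forall>z\<in>X'. c (a z) \<noteq> c z \<and> c (b z) \<noteq> c z" ..
      \<comment> \<open>Here \<open>{x, y}\<close> is closed under both involutions and can be
        coloured independently of the rest.\<close>
      show ?thesis
      proof (intro exI[of _ "c(x := True, y := False)"] ballI)
        fix z assume "z \<in> X"
        then consider "z = x" | "z = y" | "z \<in> X'" by (auto simp: X'_def)
        then show "(c(x := True, y := False)) (a z) \<noteq> (c(x := True, y := False)) z \<and>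
            (c(x := True, y := False)) (b z) \<noteq> (c(x := True, y := False)) z"
        proof cases
          case 1 then show ?thesis using y True by (simp flip: y_def)
        next
          case 2 then show ?thesis using y by_x by simp
        next
          case 3
          then have "z \<noteq> x" "z \<noteq> y" "a z \<noteq> x" "a z \<noteq> y" "b z \<noteq> x" "b z \<noteq> y"
            using a'[of z] b'[of z] by (auto simp: X'_def)
          then show ?thesis using c 3 by simp
        qed
      qed
    next
      case False
      define x' where "x' = b x"
      define y' where "y' = b y"
      have x': "x' \<in> X'" "b x' = x" using b[OF x] b[OF y(1)] False by (auto simp: X'_def x'_def)
      have y': "y' \<in> X'" "b y' = y" using b[OF x] b[OF y(1)] False by (auto simp: X'_def y'_def)
      have x'y': "x' \<noteq> y'" using x'(2) y'(2) y(3) by auto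
      define b2 where "b2 = b(x' := y', y' := x')"
      have b': "b2 z \<in> X' \<and> b2 (b2 z) = z \<and> b2 z \<noteq> z" if z: "z \<in> X'" for z
      proof (cases "z = x' \<or> z = y'")
        case True then show ?thesis using x' y' x'y' by (auto simp: b2_def)
      next
        case F: False
        have zX: "z \<in> X" "z \<noteq> x" "z \<noteq> y" using z by (auto simp: X'_def)
        have ne: "b z \<noteq> x" "b z \<noteq> y" using b[OF zX(1)] F by (auto simp: x'_def y'_def)
        have ne': "b z \<noteq> x'" "b z \<noteq> y'" using b[OF zX(1)] zX x' y' by auto
        show ?thesis using F ne ne' b[OF zX(1)] by (auto simp: b2_def X'_def)
      qed
      have "\<exists>c :: 'a \<Rightarrow> bool. \<forall>z\<in>X'. c (a z) \<noteq> c z \<and> c (b2 z) \<noteq> c z" by (rule psubset.IH[OF X']) (erule a', erule b')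
      then obtain c :: "'a \<Rightarrow> bool" where c: "\<forall>z\<in>X'. c (a z) \<noteq> c z \<and> c (b2 z) \<noteq> c z" ..
      have "b2 x' = y'" using x'y' by (simp add: b2_def)
      then have cxy: "c x' \<noteq> c y'" using c x'(1) by metis
      \<comment> \<open>Since \<open>b2\<close> matches \<open>x'\<close> with \<open>y'\<close>,
        their colours differ. Giving \<open>x\<close> the colour of \<open>y'\<close> and
        \<open>y\<close> that of \<open>x'\<close> separates \<open>x\<close> from \<open>y\<close>
        and each of them from its \<open>b\<close>-partner.\<close>
      define c2 where "c2 = c(x := c y', y := c x')"
      have c2: "c2 z = c z" if "z \<in> X'" for z using that by (auto simp: c2_def X'_def)
      have c2xy: "c2 x = c y'" "c2 y = c x'" using y(3) by (auto simp: c2_def)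
      show ?thesis
      proof (intro exI[of _ c2] ballI)
        fix z assume z: "z \<in> X"
        consider "z = x" | "z = y" | "z = x'" | "z = y'" | "z \<in> X'" "z \<noteq> x'" "z \<noteq> y'"
          using z by (auto simp: X'_def)
        then show "c2 (a z) \<noteq> c2 z \<and> c2 (b z) \<noteq> c2 z"
        proof cases
          case 1 then show ?thesis using c2xy cxy c2[OF x'(1)] unfolding 1 y_def[symmetric] x'_def[symmetric] by simp
        next
          case 2 then show ?thesis using c2xy cxy c2[OF y'(1)] y(2) unfolding 2 y'_def[symmetric] by simp
        next
          case 3 then show ?thesis using c2xy cxy c2[OF x'(1)] c2[of "a x'"] a'[OF x'(1)] c x' by simp
        next
          case 4 then show ?thesis using c2xy cxy c2[OF y'(1)] c2[of "a y'"] a'[OF y'(1)] c y' by simp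
        next
          case 5
          have "b2 z = b z" using 5 by (simp add: b2_def)
          then show ?thesis using c2[of z] c2[of "a z"] c2[of "b z"] a'[of z] b'[of z] c 5 by metis
        qed
      qed
    qed
  qed auto
qed

section \<open>Bitwise agreement and the Benes network\<close>

definition agree_outside :: "nat set \<Rightarrow> nat \<Rightarrow> nat \<Rightarrow> bool" where
  "agree_outside I x y \<longleftrightarrow> (\<forall>i. i \<notin> I \<longrightarrow> bit x i = bit y i)"

lemma agree_outside_refl [simp]: "agree_outside I x x"
  by (simp add: agree_outside_def)

lemma agree_outside_sym: "agree_outside I x y \<Longrightarrow> agree_outside I y x"
  by (auto simp: agree_outside_def)

lemma agree_outside_trans:
  "agree_outside I x y \<Longrightarrow> agree_outside J y z \<Longrightarrow> I \<subseteq> H \<Longrightarrow> J \<subseteq> H \<Longrightarrow> agree_outside H x z"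
  by (auto simp: agree_outside_def)

lemma bit_double_plus: "bit (2 * x + of_bool c :: nat) i = (if i = 0 then c else bit x (i - 1))"
  by (cases i) (auto simp: bit_0 bit_Suc)

lemma agree_outside_0:
  fixes x y :: nat
  shows "x div 2 = y div 2 \<Longrightarrow> agree_outside {0} x y"
  unfolding agree_outside_def by (metis bit_Suc insertI1 not0_implies_Suc)

lemma agree_outside_Suc:
  "agree_outside {i} x y \<Longrightarrow> agree_outside {Suc i} (2 * x + of_bool c) (2 * y + of_bool c)"
  unfolding agree_outside_def bit_double_plus by (auto simp: gr0_conv_Suc)

text \<open>Two butterflies back to back: the stages act on bits \<open>0\<close> to
  \<open>K - 1\<close> and then back down to \<open>0\<close>. Bit \<open>K - 1\<close> is treated
  twice in a row, so the recursion can start at \<open>K = 0\<close> with no stage.\<close>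

definition benes_bit :: "nat \<Rightarrow> nat \<Rightarrow> nat" where
  "benes_bit K j = (if j < K then j else 2 * K - 1 - j)"

text \<open>The colour \<open>c x\<close> selects the half network through which \<open>x\<close> is routed: inputs sharing a first
  switch and outputs sharing a last switch must get different colours.\<close>

lemma benes_routing:
  assumes "bij_betw \<pi> {..<2 ^ K} {..<2 ^ K}"
  shows "\<exists>p. (\<forall>j. inj_on (p j) {..<2 ^ K} \<and> p j ` {..<2 ^ K} \<subseteq> {..<2 ^ K}) \<and>
    (\<forall>x<2 ^ K. p 0 x = x \<and> p (2 * K) x = \<pi> x) \<and>
    (\<forall>j<2 * K. \<forall>x<2 ^ K. agree_outside {benes_bit K j} (p j x) (p (Suc j) x))"
  using assms
proof (induction K arbitrary: \<pi>)
  case 0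
  then have "\<pi> 0 = 0" by (auto simp: bij_betw_def)
  then show ?case by (intro exI[of _ "\<lambda>_ x. x"]) auto
next
  case (Suc K)
  let ?N = "2 ^ K :: nat" and ?X = "{..<2 ^ Suc K :: nat}"
  define flip where "flip x = (if even x then x + 1 else x - 1)" for x :: nat
  have flip: "flip x < 2 * ?N \<and> flip (flip x) = x \<and> flip x \<noteq> x \<and> flip x div 2 = x div 2"
    if "x < 2 * ?N" for x
    using that by (auto simp: flip_def elim!: evenE oddE)
  have flip_cases: "y = x \<or> y = flip x" if "x div 2 = y div 2" for x y
    using that by (auto simp: flip_def elim!: evenE oddE)
  have \<pi>: "inj_on \<pi> ?X" "\<pi> ` ?X = ?X" using Suc.prems by (auto simp: bij_betw_def)
  define \<sigma> where "\<sigma> = inv_into ?X \<pi>"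
  have \<sigma>: "\<sigma> z \<in> ?X" "\<pi> (\<sigma> z) = z" if "z \<in> ?X" for z
    using that \<pi>(2) inv_into_into[of z \<pi> ?X] f_inv_into_f[of z \<pi> ?X] by (auto simp: \<sigma>_def)
  have \<sigma>\<pi>: "\<sigma> (\<pi> x) = x" if "x \<in> ?X" for x using that \<pi>(1) by (simp add: \<sigma>_def)
  have \<pi>X: "\<pi> x \<in> ?X" if "x \<in> ?X" for x using that \<pi>(2) by blast
  \<comment> \<open>Besides \<open>flip\<close>, the second involution sends \<open>x\<close> to the
    input whose output shares the last switch with \<open>\<pi> x\<close>.\<close>
  have "\<exists>c :: nat \<Rightarrow> bool. \<forall>x\<in>?X. c (flip x) \<noteq> c x \<and> c (\<sigma> (flip (\<pi> x))) \<noteq> c x"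
  proof (rule two_involutions_coloring)
    fix x assume x: "x \<in> ?X"
    then show "flip x \<in> ?X \<and> flip (flip x) = x \<and> flip x \<noteq> x" using flip[of x] by auto
    have f: "flip (\<pi> x) \<in> ?X" "flip (flip (\<pi> x)) = \<pi> x" "flip (\<pi> x) \<noteq> \<pi> x"
      using flip[of "\<pi> x"] \<pi>X[OF x] by auto
    show "\<sigma> (flip (\<pi> x)) \<in> ?X \<and> \<sigma> (flip (\<pi> (\<sigma> (flip (\<pi> x))))) = x \<and> \<sigma> (flip (\<pi> x)) \<noteq> x"
      using \<sigma>[OF f(1)] f \<sigma>\<pi>[OF x] by metis
  qed simp
  then obtain c :: "nat \<Rightarrow> bool"
    where c: "\<And>x. x \<in> ?X \<Longrightarrow> c (flip x) \<noteq> c x \<and> c (\<sigma> (flip (\<pi> x))) \<noteq> c x" by blast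
  have c_in: "x = y" if "x \<in> ?X" "y \<in> ?X" "c x = c y" "x div 2 = y div 2" for x y
    using flip_cases[OF that(4)] c[OF that(1)] that by metis
  have c_out: "x = y" if "x \<in> ?X" "y \<in> ?X" "c x = c y" "\<pi> x div 2 = \<pi> y div 2" for x y
    using flip_cases[OF that(4)] c[OF that(1)] \<sigma>\<pi>[OF that(1)] \<sigma>\<pi>[OF that(2)] that by metis
  \<comment> \<open>\<open>\<xi> b y\<close> is the input of colour \<open>b\<close> at the
    first-stage switch \<open>y\<close>, and \<open>\<beta> b\<close> below is the permutation left
    to half network \<open>b\<close>.\<close>
  define \<xi> where "\<xi> b y = (if c (2 * y) = b then 2 * y else 2 * y + 1)" for b and y :: nat
  have \<xi>: "\<xi> b y \<in> ?X" "c (\<xi> b y) = b" "\<xi> b y div 2 = y" if "y < ?N" for b y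
  proof -
    have "c (flip (2 * y)) \<noteq> c (2 * y)" using c[of "2 * y"] that by auto
    then show "\<xi> b y \<in> ?X" "c (\<xi> b y) = b" "\<xi> b y div 2 = y"
      using that by (auto simp: \<xi>_def flip_def)
  qed
  define \<beta> where "\<beta> b y = \<pi> (\<xi> b y) div 2" for b y
  have \<beta>: "bij_betw (\<beta> b) {..<?N} {..<?N}" for b
  proof -
    have inj: "inj_on (\<beta> b) {..<?N}"
    proof (rule inj_onI)
      fix y z assume yz: "y \<in> {..<?N}" "z \<in> {..<?N}" "\<beta> b y = \<beta> b z"
      then have "\<xi> b y = \<xi> b z"
        using \<xi>(1,2)[of y b] \<xi>(1,2)[of z b] c_out[of "\<xi> b y" "\<xi> b z"] by (simp add: \<beta>_def)
      then show "y = z" using \<xi>(3) yz by (metis lessThan_iff)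
    qed
    moreover have "\<beta> b y < ?N" if "y < ?N" for y
      using \<pi>X[OF \<xi>(1)[OF that], of b] by (simp add: \<beta>_def less_mult_imp_div_less mult.commute)
    then have "\<beta> b ` {..<?N} \<subseteq> {..<?N}" by auto
    ultimately show ?thesis by (simp add: bij_betw_def endo_inj_surj)
  qed
  have "\<exists>p. (\<forall>j. inj_on (p j) {..<?N} \<and> p j ` {..<?N} \<subseteq> {..<?N}) \<and>
    (\<forall>x<?N. p 0 x = x \<and> p (2 * K) x = \<beta> b x) \<and>
    (\<forall>j<2 * K. \<forall>x<?N. agree_outside {benes_bit K j} (p j x) (p (Suc j) x))" for b
    by (rule Suc.IH[OF \<beta>])
  then obtain p where p: "\<And>b j. inj_on (p b j) {..<?N}" "\<And>b j. p b j ` {..<?N} \<subseteq> {..<?N}"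
    "\<And>b x. x < ?N \<Longrightarrow> p b 0 x = x \<and> p b (2 * K) x = \<beta> b x"
    "\<And>b j x. j < 2 * K \<Longrightarrow> x < ?N \<Longrightarrow> agree_outside {benes_bit K j} (p b j x) (p b (Suc j) x)"
    by metis
  \<comment> \<open>Half network \<open>c x\<close> occupies the rows whose lowest bit is
    \<open>c x\<close>, so entering and leaving it changes only bit 0.\<close>
  define mid where "mid j x = 2 * p (c x) j (x div 2) + of_bool (c x)" for j x
  have half: "x div 2 < ?N" if "x \<in> ?X" for x using that by auto
  have p_less: "p b j y < ?N" if "y < ?N" for b j y using p(2)[where b = b and j = j] that by blast
  have mid_X: "mid j x \<in> ?X" if "x \<in> ?X" for j x
    using p_less[OF half[OF that], of "c x" j] by (auto simp: mid_def)
  have mid_inj: "inj_on (mid j) ?X" for j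
  proof (rule inj_onI)
    fix x y assume xy: "x \<in> ?X" "y \<in> ?X" "mid j x = mid j y"
    have "mid j x mod 2 = mid j y mod 2" "mid j x div 2 = mid j y div 2" using xy(3) by auto
    then have cc: "c x = c y" and "p (c x) j (x div 2) = p (c y) j (y div 2)"
      unfolding mid_def by (auto split: if_splits simp: of_bool_def)
    then have "x div 2 = y div 2" using p(1)[of "c x" j] half[OF xy(1)] half[OF xy(2)] by (auto simp: inj_on_def)
    then show "x = y" using c_in[OF xy(1,2) cc] by simp
  qed
  define q where "q j = (if j = 0 then (\<lambda>x. x) else if j = 2 * Suc K then \<pi> else mid (j - 1))" for j
  show ?case
  proof (intro exI[of _ q] conjI allI impI)
    fix j show "inj_on (q j) ?X" using mid_inj \<pi>(1) by (auto simp: q_def)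
    show "q j ` ?X \<subseteq> ?X" using mid_X \<pi>(2) by (auto simp: q_def)
  next
    fix x show "q 0 x = x" "q (2 * Suc K) x = \<pi> x" by (auto simp: q_def)
  next
    fix j and x :: nat assume j: "j < 2 * Suc K" and "x < 2 ^ Suc K"
    then have x: "x \<in> ?X" by auto
    consider "j = 0" | "j = Suc (2 * K)" | i where "j = Suc i" "i < 2 * K"
      using j by (cases j) (auto simp: less_Suc_eq)
    then show "agree_outside {benes_bit (Suc K) j} (q j x) (q (Suc j) x)"
    proof cases
      case 1
      have "mid 0 x div 2 = x div 2" using p(3)[OF half[OF x]] by (auto simp: mid_def)
      then have "agree_outside {0} x (mid 0 x)" by (intro agree_outside_0) simp
      then show ?thesis using 1 by (simp add: q_def benes_bit_def)
    next
      case 2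
      have "\<xi> (c x) (x div 2) = x" using \<xi>[OF half[OF x], of "c x"] c_in[of "\<xi> (c x) (x div 2)" x] x by blast
      then have "mid (2 * K) x div 2 = \<pi> x div 2" using p(3)[OF half[OF x]] by (auto simp: mid_def \<beta>_def)
      then have "agree_outside {0} (mid (2 * K) x) (\<pi> x)" by (rule agree_outside_0)
      then show ?thesis using 2 by (simp add: q_def benes_bit_def)
    next
      case (3 i)
      have "benes_bit (Suc K) j = Suc (benes_bit K i)" using 3 by (auto simp: benes_bit_def)
      moreover have "agree_outside {Suc (benes_bit K i)} (mid i x) (mid (Suc i) x)"
        unfolding mid_def using p(4)[OF 3(2) half[OF x]] by (rule agree_outside_Suc)
      ultimately show ?thesis using 3 by (simp add: q_def)
    qed
  qed
qed

section \<open>The network\<close>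

definition bit_group :: "nat \<Rightarrow> nat \<Rightarrow> nat set" where
  "bit_group e g = {g * e..<Suc g * e}"

text \<open>Consecutive single-bit stages that act on the bits of one group are merged into one
  stage.\<close>

lemma benes_group_routing:
  assumes "bij_betw \<pi> {..<2 ^ K} {..<2 ^ K}" "K \<le> k * e"
  shows "\<exists>q. (\<forall>j. inj_on (q j) {..<2 ^ K} \<and> q j ` {..<2 ^ K} \<subseteq> {..<2 ^ K}) \<and>
    (\<forall>x<2 ^ K. q 0 x = x \<and> q (2 * k) x = \<pi> x) \<and>
    (\<forall>j<2 * k. \<forall>x<2 ^ K. agree_outside (bit_group e (benes_bit k j)) (q j x) (q (Suc j) x))"
proof -
  obtain p where p: "\<And>j. inj_on (p j) {..<2 ^ K} \<and> p j ` {..<2 ^ K} \<subseteq> {..<2 ^ K}"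
    "\<And>x. x < 2 ^ K \<Longrightarrow> p 0 x = x \<and> p (2 * K) x = \<pi> x"
    "\<And>j x. j < 2 * K \<Longrightarrow> x < 2 ^ K \<Longrightarrow> agree_outside {benes_bit K j} (p j x) (p (Suc j) x)"
    using benes_routing[OF assms(1)] by blast
  have range: "agree_outside I (p i x) (p (i + m) x)"
    if "i + m \<le> 2 * K" "x < 2 ^ K" "\<And>t. i \<le> t \<Longrightarrow> t < i + m \<Longrightarrow> benes_bit K t \<in> I" for I i m x
    using that
  proof (induction m)
    case (Suc m)
    have "agree_outside I (p i x) (p (i + m) x)" using Suc by simp
    moreover have "agree_outside {benes_bit K (i + m)} (p (i + m) x) (p (i + Suc m) x)"
      using p(3)[of "i + m" x] Suc.prems by simp
    moreover have "benes_bit K (i + m) \<in> I" using Suc.prems(3) by simp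
    ultimately show ?case by (auto intro: agree_outside_trans)
  qed simp
  \<comment> \<open>\<open>pos j\<close> counts the single-bit stages completed after
    \<open>j\<close> merged ones. The \<open>min\<close> allows for a last group that is not full,
    and the second half mirrors the first.\<close>
  define pos where "pos j = (if j < k then min (j * e) K else 2 * K - min ((2 * k - j) * e) K)" for j
  have "agree_outside (bit_group e (benes_bit k j)) (p (pos j) x) (p (pos (Suc j)) x)"
    if j: "j < 2 * k" and x: "x < 2 ^ K" for j x
  proof -
    have step: "pos j \<le> pos (Suc j) \<and> pos (Suc j) \<le> 2 * K \<and>
        (\<forall>t. pos j \<le> t \<longrightarrow> t < pos (Suc j) \<longrightarrow> benes_bit K t \<in> bit_group e (benes_bit k j))"
    proof (cases "j < k")
      case True
      have pj: "pos j = min (j * e) K" using True by (simp add: pos_def)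
      \<comment> \<open>At the turning point \<open>Suc j = k\<close> the other formula applies;
        both give \<open>K\<close> because \<open>K <= k * e\<close>.\<close>
      have "pos (Suc j) = min (Suc j * e) K"
      proof (cases "Suc j = k")
        case True
        then have "2 * k - Suc j = k" "K \<le> Suc j * e" using assms(2) by auto
        then show ?thesis using True assms(2) by (simp add: pos_def)
      next
        case False
        then show ?thesis using True by (simp add: pos_def)
      qed
      then show ?thesis using True pj by (auto simp: benes_bit_def bit_group_def)
    next
      case False
      define r where "r = 2 * k - Suc j"
      have r: "2 * k - j = Suc r" "benes_bit k j = r"
        using False j by (auto simp: r_def benes_bit_def)
      have pj: "pos j = 2 * K - min (Suc r * e) K" "pos (Suc j) = 2 * K - min (r * e) K"
        using False r by (auto simp: pos_def r_def)
      have le: "r * e \<le> Suc r * e" by simp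
      have "benes_bit K t \<in> bit_group e r" if "pos j \<le> t" "t < pos (Suc j)" for t
        using that unfolding pj benes_bit_def bit_group_def by (auto simp: min_def split: if_splits)
      moreover have "pos j \<le> pos (Suc j)" unfolding pj using le by (intro diff_le_mono2 min.mono) auto
      moreover have "pos (Suc j) \<le> 2 * K" unfolding pj by simp
      ultimately show ?thesis unfolding r(2) by blast
    qed
    then show ?thesis
      using range[of "pos j" "pos (Suc j) - pos j" x "bit_group e (benes_bit k j)"] x by auto
  qed
  moreover have "pos 0 = 0" using assms(2) by (cases k) (auto simp: pos_def)
  moreover have "pos (2 * k) = 2 * K" using assms(2) by (cases k) (auto simp: pos_def)
  ultimately show ?thesis
    using p(1,2) by (intro exI[of _ "\<lambda>j. p (pos j)"]) auto
qed

section \<open>Counting pairs of rows within a block\<close>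

lemma card_agreeing_le:
  "card {y. y < N \<and> agree_outside (bit_group e g) x y} \<le> 2 ^ e"
proof -
  let ?f = "\<lambda>y::nat. take_bit e (drop_bit (g * e) y)"
  have "inj_on ?f {y. y < N \<and> agree_outside (bit_group e g) x y}"
  proof (rule inj_onI)
    fix y z assume yz: "y \<in> {y. y < N \<and> agree_outside (bit_group e g) x y}"
      "z \<in> {y. y < N \<and> agree_outside (bit_group e g) x y}" "?f y = ?f z"
    show "y = z"
    proof (rule bit_eqI)
      fix i
      show "bit y i = bit z i"
      proof (cases "i \<in> bit_group e g")
        case False then show ?thesis using yz by (auto simp: agree_outside_def)
      next
        case True
        have "bit (?f y) (i - g * e) = bit (?f z) (i - g * e)" using yz(3) by simp
        then show ?thesis using True by (auto simp: bit_take_bit_iff bit_drop_bit_eq bit_group_def)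
      qed
    qed
  qed
  moreover have "?f ` {y. y < N \<and> agree_outside (bit_group e g) x y} \<subseteq> {..<2 ^ e}" by auto
  ultimately show ?thesis
    using card_inj_on_le[of ?f _ "{..<2 ^ e}"] by auto
qed

definition block_pairs :: "nat \<Rightarrow> nat \<Rightarrow> (nat \<times> nat) set" where
  "block_pairs K e = {(x, y). x < 2 ^ K \<and> y < 2 ^ K \<and> agree_outside (bit_group e 0) x y}"

lemma finite_block_pairs [simp]: "finite (block_pairs K e)"
  by (rule finite_subset[of _ "{..<2 ^ K} \<times> {..<2 ^ K}"]) (auto simp: block_pairs_def)

lemma agree_outside_lowest_group:
  fixes x y :: nat
  assumes "x div 2 ^ e = y div 2 ^ e"
  shows "agree_outside (bit_group e 0) x y"
proof -
  have "bit x i = bit y i" if "e \<le> i" for i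
  proof -
    have "bit (drop_bit e x) (i - e) = bit (drop_bit e y) (i - e)" using assms by (simp add: drop_bit_eq_div)
    then show ?thesis using that by (simp add: bit_drop_bit_eq)
  qed
  then show ?thesis by (auto simp: agree_outside_def bit_group_def)
qed

text \<open>\<open>e <= K\<close> makes \<open>2 ^ K\<close> a multiple of the block size, so each
  \<open>x\<close> has a full block of \<open>2 ^ e\<close> partners.\<close>

lemma card_block_pairs_ge:
  assumes "e \<le> K"
  shows "2 ^ K * 2 ^ e \<le> card (block_pairs K e)"
proof -
  let ?d = "2 ^ e :: nat"
  let ?f = "\<lambda>(x, t). (x, ?d * (x div ?d) + t)"
  have N: "2 ^ K = ?d * 2 ^ (K - e)" using assms by (simp flip: power_add)
  have "?f (x, t) \<in> block_pairs K e" if x: "x < 2 ^ K" and t: "t < ?d" for x t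
  proof -
    have "x div ?d < 2 ^ (K - e)" using x N by (simp add: less_mult_imp_div_less mult.commute)
    then have "?d * (x div ?d) + ?d \<le> ?d * 2 ^ (K - e)"
      using mult_le_mono2[of "Suc (x div ?d)" "2 ^ (K - e)" ?d] by simp
    then have "?d * (x div ?d) + t < 2 ^ K" using t N by linarith
    moreover have "agree_outside (bit_group e 0) x (?d * (x div ?d) + t)"
      using t by (intro agree_outside_lowest_group) simp
    ultimately show ?thesis using x by (simp add: block_pairs_def)
  qed
  then have "?f ` ({..<2 ^ K} \<times> {..<?d}) \<subseteq> block_pairs K e" by auto
  moreover have "inj_on ?f ({..<2 ^ K} \<times> {..<?d})" by (auto simp: inj_on_def)
  ultimately have "card ({..<2 ^ K :: nat} \<times> {..<?d}) \<le> card (block_pairs K e)"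
    by (intro card_inj_on_le) auto
  then show ?thesis by (simp add: card_cartesian_product)
qed

lemma card_block_pairs_fst_le:
  assumes "finite U"
  shows "card {z \<in> block_pairs K e. fst z \<in> U} \<le> card U * 2 ^ e"
proof -
  have "{z \<in> block_pairs K e. fst z \<in> U} \<subseteq> (SIGMA x:U. {y. y < 2 ^ K \<and> agree_outside (bit_group e 0) x y})"
    by (auto simp: block_pairs_def)
  then have "card {z \<in> block_pairs K e. fst z \<in> U}
      \<le> card (SIGMA x:U. {y. y < 2 ^ K \<and> agree_outside (bit_group e 0) x y})"
    using assms by (intro card_mono) auto
  also have "\<dots> = (\<Sum>x\<in>U. card {y. y < 2 ^ K \<and> agree_outside (bit_group e 0) x y})"
    using assms by (intro card_SigmaI) auto
  also have "\<dots> \<le> (\<Sum>x\<in>U. 2 ^ e)" by (intro sum_mono card_agreeing_le)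
  finally show ?thesis by simp
qed

lemma card_block_pairs_snd_le:
  assumes "finite U"
  shows "card {z \<in> block_pairs K e. snd z \<in> U} \<le> card U * 2 ^ e"
proof -
  have "prod.swap ` {z \<in> block_pairs K e. snd z \<in> U} \<subseteq> {z \<in> block_pairs K e. fst z \<in> U}"
    by (auto simp: block_pairs_def intro: agree_outside_sym)
  then have "card {z \<in> block_pairs K e. snd z \<in> U} \<le> card {z \<in> block_pairs K e. fst z \<in> U}"
    by (intro card_inj_on_le[of prod.swap]) auto
  then show ?thesis using card_block_pairs_fst_le[OF assms, of K e] by linarith
qed

text \<open>Greedy choice: new pairs must avoid rows already taken and must not have all
  \<open>b\<close> copies inside \<open>S i\<close>. Either restriction excludes at most half of the
  guaranteed \<open>2 ^ K * 2 ^ e\<close> pairs, the first strictly less.\<close>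

lemma escaping_pairs:
  fixes f :: "nat \<Rightarrow> nat \<times> nat \<Rightarrow> 'b" and S :: "nat \<Rightarrow> 'b set"
  assumes e: "e \<le> K" and R: "4 * R \<le> 2 ^ K" and b: "0 < b"
    and f: "inj_on (\<lambda>(j, z). f j z) ({..<b} \<times> block_pairs K e)"
    and S: "\<And>i. finite (S i) \<and> 2 * card (S i) \<le> b * (2 ^ K * 2 ^ e)"
  shows "\<exists>x y. inj_on x {..<R} \<and> inj_on y {..<R} \<and>
    (\<forall>i<R. (x i, y i) \<in> block_pairs K e \<and> (\<exists>j<b. f j (x i, y i) \<notin> S i))"
  using R
proof (induction R)
  case 0
  then show ?case by simp
next
  case (Suc r)
  let ?d = "2 ^ e :: nat" and ?E = "block_pairs K e"
  obtain x y where xy: "inj_on x {..<r}" "inj_on y {..<r}"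
    "\<And>i. i < r \<Longrightarrow> (x i, y i) \<in> ?E \<and> (\<exists>j<b. f j (x i, y i) \<notin> S i)"
    using Suc by auto
  define bad where "bad = {z \<in> ?E. \<forall>j<b. f j z \<in> S r}"
  \<comment> \<open>The copies of bad pairs are distinct elements of \<open>S r\<close>, so there
    are at most \<open>card (S r) / b\<close> bad pairs.\<close>
  have "card ({..<b} \<times> bad) \<le> card (S r)"
  proof (rule card_inj_on_le)
    show "inj_on (\<lambda>(j, z). f j z) ({..<b} \<times> bad)"
      by (rule inj_on_subset[OF f]) (auto simp: bad_def)
    show "(\<lambda>(j, z). f j z) ` ({..<b} \<times> bad) \<subseteq> S r" by (auto simp: bad_def)
    show "finite (S r)" using S by blast
  qed
  then have "2 * (b * card bad) \<le> b * (2 ^ K * ?d)"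
    using S[of r] unfolding card_cartesian_product card_lessThan by linarith
  then have "b * (2 * card bad) \<le> b * (2 ^ K * ?d)" unfolding mult.left_commute[of b 2] .
  then have bad: "2 * card bad \<le> 2 ^ K * ?d" using b nat_mult_le_cancel1[of b] by blast
  let ?X = "{z \<in> ?E. fst z \<in> x ` {..<r}}" and ?Y = "{z \<in> ?E. snd z \<in> y ` {..<r}}"
  have X: "card ?X \<le> r * ?d" and Y: "card ?Y \<le> r * ?d"
    using card_block_pairs_fst_le[of "x ` {..<r}" K e] card_block_pairs_snd_le[of "y ` {..<r}" K e] xy
    by (simp_all add: card_image)
  have "card (?X \<union> ?Y \<union> bad) \<le> card ?X + card ?Y + card bad"
    using card_Un_le[of "?X \<union> ?Y" bad] card_Un_le[of ?X ?Y] by linarith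
  then have "2 * card (?X \<union> ?Y \<union> bad) \<le> 4 * r * ?d + 2 ^ K * ?d" using X Y bad by linarith
  also have "\<dots> < 2 * (2 ^ K * ?d)"
  proof -
    have "4 * r < 2 ^ K" using Suc.prems by simp
    then have "4 * r * ?d < 2 ^ K * ?d" by simp
    then show ?thesis by linarith
  qed
  also have "\<dots> \<le> 2 * card ?E" using card_block_pairs_ge[OF e] by simp
  finally have "card (?X \<union> ?Y \<union> bad) < card ?E" by simp
  then have "\<not> ?E \<subseteq> ?X \<union> ?Y \<union> bad"
    using card_mono[of "?X \<union> ?Y \<union> bad" ?E] by (auto simp: bad_def)
  then obtain z' where "z' \<in> ?E" "z' \<notin> ?X \<union> ?Y \<union> bad" by blast
  then obtain x' y' where z: "(x', y') \<in> ?E" "(x', y') \<notin> ?X \<union> ?Y \<union> bad" by (cases z') blast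
  show ?case
  proof (rule exI[of _ "x(r := x')"], rule exI[of _ "y(r := y')"], intro conjI allI impI)
    show "inj_on (x(r := x')) {..<Suc r}" using xy(1) z by (auto simp: lessThan_Suc inj_on_def)
    show "inj_on (y(r := y')) {..<Suc r}" using xy(2) z by (auto simp: lessThan_Suc inj_on_def)
    fix i assume "i < Suc r"
    then show "((x(r := x')) i, (y(r := y')) i) \<in> ?E"
      and "\<exists>j<b. f j ((x(r := x')) i, (y(r := y')) i) \<notin> S i"
      using xy(3)[of i] z by (auto simp: less_Suc_eq bad_def)
  qed
qed

lemma bij_betw_extend:
  assumes "finite B" "A \<subseteq> B" "inj_on f A" "f ` A \<subseteq> B"
  shows "\<exists>g. bij_betw g B B \<and> (\<forall>x\<in>A. g x = f x)"
proof -
  have fA: "finite A" using assms finite_subset by blast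
  have "card (B - A) = card (B - f ` A)"
    using assms fA by (simp add: card_Diff_subset card_image)
  then obtain h where h: "bij_betw h (B - A) (B - f ` A)"
    using finite_same_card_bij[of "B - A" "B - f ` A"] assms(1) by auto
  define g where "g x = (if x \<in> A then f x else h x)" for x
  have "bij_betw g A (f ` A)"
    using assms(3) by (simp add: bij_betw_def g_def inj_on_def)
  moreover have "bij_betw g (B - A) (B - f ` A)"
    using h by (subst bij_betw_cong[of _ g h]) (auto simp: g_def)
  ultimately have "bij_betw g (A \<union> (B - A)) (f ` A \<union> (B - f ` A))" by (rule bij_betw_combine) auto
  moreover have "A \<union> (B - A) = B" "f ` A \<union> (B - f ` A) = B" using assms by auto
  ultimately show ?thesis by (intro exI[of _ g]) (auto simp: g_def)
qed

text \<open>The source is \<open>0\<close>; the other vertices form \<open>4 * k\<close> cyclic levels of \<open>2 ^ K\<close> vertices. The arcs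
  leaving the first \<open>2 * k\<close> levels (the bank) join vertices that agree outside the lowest \<open>e\<close> bits, those
  leaving the last \<open>2 * k\<close> levels form a Benes network on groups of \<open>e\<close> bits.\<close>

definition net_vertex :: "nat \<Rightarrow> nat \<Rightarrow> nat \<Rightarrow> nat" where
  "net_vertex K x j = 1 + (j * 2 ^ K + x)"

definition level_group :: "nat \<Rightarrow> nat \<Rightarrow> nat" where
  "level_group k j = (if j < 2 * k then 0 else benes_bit k (j - 2 * k))"

definition net_arcs :: "nat \<Rightarrow> nat \<Rightarrow> nat \<Rightarrow> (nat \<times> nat) set" where
  "net_arcs K e k = (\<lambda>x. (0, net_vertex K x 0)) ` {..<2 ^ K} \<union>
     (\<Union>j<4 * k. (\<lambda>(x, y). (net_vertex K x j, net_vertex K y (Suc j mod (4 * k)))) `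
       (SIGMA x:{..<2 ^ K}. {y. y < 2 ^ K \<and> agree_outside (bit_group e (level_group k j)) x y}))"

lemma net_vertex_eq_iff:
  assumes "x < 2 ^ K" "y < 2 ^ K"
  shows "net_vertex K x i = net_vertex K y j \<longleftrightarrow> x = y \<and> i = j"
proof
  assume "net_vertex K x i = net_vertex K y j"
  then have eq: "i * 2 ^ K + x = j * 2 ^ K + y" by (simp add: net_vertex_def)
  have "(i * 2 ^ K + x) div 2 ^ K = i" "(j * 2 ^ K + y) div 2 ^ K = j" using assms by auto
  then show "x = y \<and> i = j" using eq by auto
qed simp

lemma net_vertex_less:
  assumes "x < 2 ^ K" "j < L"
  shows "net_vertex K x j < 1 + L * 2 ^ K"
proof -
  have "Suc j * 2 ^ K \<le> L * 2 ^ K" using assms(2) by (intro mult_le_mono1) auto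
  then show ?thesis using assms(1) by (simp add: net_vertex_def)
qed

lemma net_arcsI:
  assumes "j < 4 * k" "x < 2 ^ K" "y < 2 ^ K" "agree_outside (bit_group e (level_group k j)) x y"
  shows "(net_vertex K x j, net_vertex K y (Suc j mod (4 * k))) \<in> net_arcs K e k"
  unfolding net_arcs_def using assms by (intro UnI2 UN_I[of j] image_eqI[of _ _ "(x, y)"]) auto

lemma net_arcs_properties:
  assumes "0 < k"
  shows "card (net_arcs K e k) \<le> 2 ^ K + 4 * k * (2 ^ K * 2 ^ e)"
    and "(u, v) \<in> net_arcs K e k \<Longrightarrow> u \<noteq> v \<and> u < 1 + 4 * k * 2 ^ K \<and> v < 1 + 4 * k * 2 ^ K"
proof -
  let ?S = "\<lambda>j. SIGMA x:{..<2 ^ K}. {y. y < 2 ^ K \<and> agree_outside (bit_group e (level_group k j)) x y}"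
  let ?A = "\<lambda>j. (\<lambda>(x, y). (net_vertex K x j, net_vertex K y (Suc j mod (4 * k)))) ` ?S j"
  have fin: "finite (?S j)" for j by auto
  have "card (?A j) \<le> 2 ^ K * 2 ^ e" for j
  proof -
    have "card (?A j) \<le> card (?S j)" by (rule card_image_le[OF fin])
    also have "\<dots> = (\<Sum>x\<in>{..<2 ^ K}. card {y. y < 2 ^ K \<and> agree_outside (bit_group e (level_group k j)) x y})"
      by (intro card_SigmaI) auto
    also have "\<dots> \<le> (\<Sum>x\<in>{..<2 ^ K :: nat}. 2 ^ e)" by (intro sum_mono card_agreeing_le)
    finally show ?thesis by simp
  qed
  then have "card (\<Union>j<4 * k. ?A j) \<le> (\<Sum>j<4 * k. 2 ^ K * 2 ^ e)"
    by (intro order_trans[OF card_UN_le] sum_mono) auto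
  moreover have "card ((\<lambda>x. (0 :: nat, net_vertex K x 0)) ` {..<2 ^ K}) \<le> 2 ^ K"
    using card_image_le[of "{..<2 ^ K :: nat}"] by (metis card_lessThan finite_lessThan)
  ultimately show "card (net_arcs K e k) \<le> 2 ^ K + 4 * k * (2 ^ K * 2 ^ e)"
    unfolding net_arcs_def by (intro order_trans[OF card_Un_le]) auto
  assume "(u, v) \<in> net_arcs K e k"
  then consider x where "x < 2 ^ K" "u = 0" "v = net_vertex K x 0"
    | j x y where "j < 4 * k" "x < 2 ^ K" "y < 2 ^ K" "u = net_vertex K x j"
        "v = net_vertex K y (Suc j mod (4 * k))"
    unfolding net_arcs_def by auto
  then show "u \<noteq> v \<and> u < 1 + 4 * k * 2 ^ K \<and> v < 1 + 4 * k * 2 ^ K"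
  proof cases
    case 1
    then show ?thesis using net_vertex_less[of x K 0 "4 * k"] assms by (auto simp: net_vertex_def)
  next
    case 2
    have "Suc j mod (4 * k) < 4 * k" using assms by simp
    moreover have "j \<noteq> Suc j mod (4 * k)"
    proof (cases "Suc j = 4 * k")
      case True
      then have "j \<noteq> 0" by presburger
      then show ?thesis using True by simp
    next
      case False
      then show ?thesis using 2(1) by simp
    qed
    ultimately show ?thesis
      using net_vertex_less[of x K j "4 * k"] net_vertex_less[of y K "Suc j mod (4 * k)" "4 * k"]
        net_vertex_eq_iff[of x K y] 2 by auto
  qed
qed

text \<open>The zigzag goes from the first row to the second on even levels and back on odd ones.
  The bank has an even number of levels, so it is left in the first row.\<close>

definition bank_arc :: "nat \<Rightarrow> nat \<Rightarrow> nat \<times> nat \<Rightarrow> nat \<times> nat" where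
  "bank_arc K j z = (if even j then (net_vertex K (fst z) j, net_vertex K (snd z) (Suc j))
     else (net_vertex K (snd z) j, net_vertex K (fst z) (Suc j)))"

text \<open>The tail of the arc reveals the level, and the parity of the level tells which end
  carries which component.\<close>

lemma inj_on_bank_arc: "inj_on (\<lambda>(j, z). bank_arc K j z) ({..<b} \<times> block_pairs K e)"
proof -
  have inj: "j = j' \<and> z = z'"
    if "z \<in> block_pairs K e" "z' \<in> block_pairs K e" "bank_arc K j z = bank_arc K j' z'" for j j' z z'
  proof -
    let ?a = "\<lambda>j z. if even j then fst z else snd z" and ?b = "\<lambda>j z. if even j then snd z else fst z"
    have arc: "bank_arc K j z = (net_vertex K (?a j z) j, net_vertex K (?b j z) (Suc j))" for j z
      by (simp add: bank_arc_def)
    have less: "?a j z < 2 ^ K" "?b j z < 2 ^ K" if "z \<in> block_pairs K e" for j z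
      using that by (simp_all add: block_pairs_def case_prod_unfold)
    have "?a j z = ?a j' z' \<and> j = j'" "?b j z = ?b j' z'"
      using that(3) net_vertex_eq_iff[OF less(1)[OF that(1)] less(1)[OF that(2)]]
        net_vertex_eq_iff[OF less(2)[OF that(1)] less(2)[OF that(2)]]
      unfolding arc prod.inject by metis+
    then show ?thesis by (cases "even j'") (auto simp: prod_eq_iff)
  qed
  show ?thesis
  proof (rule inj_onI)
    fix p p' assume "p \<in> {..<b} \<times> block_pairs K e" "p' \<in> {..<b} \<times> block_pairs K e"
      "(case p of (j, z) \<Rightarrow> bank_arc K j z) = (case p' of (j, z) \<Rightarrow> bank_arc K j z)"
    then show "p = p'" using inj[of "snd p" "snd p'" "fst p" "fst p'"]
      by (simp add: case_prod_unfold mem_Times_iff prod_eq_iff)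
  qed
qed

text \<open>The path is simple because at each level different passes use different rows: in the
  bank by injectivity of \<open>x\<close> and \<open>y\<close>, in the router by injectivity of each
  stage.\<close>

lemma net_path:
  assumes k: "0 < k" "K \<le> k * e" and R: "0 < R"
    and x: "inj_on x {..<R}" and y: "inj_on y {..<R}"
    and xy: "\<And>i. i < R \<Longrightarrow> (x i, y i) \<in> block_pairs K e"
  shows "\<exists>v. path_from (net_arcs K e k) 0 v (R * (4 * k) - 1) \<and>
    (\<forall>i<R. \<forall>j<2 * k. (v (i * (4 * k) + j), v (Suc (i * (4 * k) + j))) = bank_arc K j (x i, y i))"
proof -
  define L where "L = 4 * k"
  let ?N = "2 ^ K :: nat"
  have xN: "x i < ?N" and yN: "y i < ?N" and agree: "agree_outside (bit_group e 0) (x i) (y i)" if "i < R" for i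
    using xy[OF that] by (auto simp: block_pairs_def)
  \<comment> \<open>The row of a pass is sent to the row of the next pass. The last row has no
    successor, so this is a partial injection, to be extended to a permutation.\<close>
  define \<sigma> where "\<sigma> = (\<lambda>z. x (Suc (inv_into {..<R} x z)))"
  have \<sigma>: "\<sigma> (x i) = x (Suc i)" if "i < R" for i using x that by (simp add: \<sigma>_def)
  have "\<exists>\<pi>. bij_betw \<pi> {..<?N} {..<?N} \<and> (\<forall>z\<in>x ` {..<R - 1}. \<pi> z = \<sigma> z)"
  proof (rule bij_betw_extend)
    show "x ` {..<R - 1} \<subseteq> {..<?N}" using xN by auto
    have "a = b" if "x (Suc a) = x (Suc b)" "Suc a < R" "Suc b < R" for a b
      using x that by (auto simp: inj_on_def)
    then show "inj_on \<sigma> (x ` {..<R - 1})"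
      using \<sigma> by (fastforce intro!: inj_onI)
    show "\<sigma> ` x ` {..<R - 1} \<subseteq> {..<?N}" using xN \<sigma> by auto
  qed simp
  then obtain \<pi> where \<pi>: "bij_betw \<pi> {..<?N} {..<?N}" "\<And>i. Suc i < R \<Longrightarrow> \<pi> (x i) = x (Suc i)"
    using \<sigma> by fastforce
  obtain q where q: "\<And>j. inj_on (q j) {..<?N}" "\<And>j. q j ` {..<?N} \<subseteq> {..<?N}"
    "\<And>z. z < ?N \<Longrightarrow> q 0 z = z" "\<And>z. z < ?N \<Longrightarrow> q (2 * k) z = \<pi> z"
    "\<And>j z. j < 2 * k \<Longrightarrow> z < ?N \<Longrightarrow> agree_outside (bit_group e (benes_bit k j)) (q j z) (q (Suc j) z)"
    using benes_group_routing[OF \<pi>(1) k(2)] by blast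
  define w where "w i j = (if j \<le> 2 * k then if even j then x i else y i else q (j - 2 * k) (x i))" for i j
  define v where "v t = net_vertex K (w (t div L) (t mod L)) (t mod L)" for t
  have L: "0 < L" using k by (simp add: L_def)
  have v: "v (i * L + j) = net_vertex K (w i j) j" if "j < L" for i j using that by (simp add: v_def)
  have wN: "w i j < ?N" if "i < R" for i j
    using xN[OF that] yN[OF that] q(2)[of "j - 2 * k"] by (auto simp: w_def)
  have winj: "i = i'" if "i < R" "i' < R" "w i j = w i' j" for i i' j
  proof -
    have "x i = x i' \<or> y i = y i'"
      using that(3) q(1)[of "j - 2 * k"] xN[OF that(1)] xN[OF that(2)]
      by (auto simp: w_def inj_on_def split: if_splits)
    then show ?thesis using x y that by (auto simp: inj_on_def)
  qed
  have bounds: "t div L < R" if "t < R * L" for t using that by (simp add: less_mult_imp_div_less)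
  have inj: "inj_on v {..R * L - 1}"
  proof (rule inj_onI)
    fix t t' assume t: "t \<in> {..R * L - 1}" "t' \<in> {..R * L - 1}" "v t = v t'"
    have "0 < R * L" using R L by simp
    then have "t < R * L" "t' < R * L" using t(1,2) unfolding atMost_iff by linarith+
    then have i: "t div L < R" "t' div L < R" using bounds by auto
    then have "t mod L = t' mod L" "t div L = t' div L"
      using t(3) wN winj by (auto simp: v_def net_vertex_eq_iff)
    then show "t = t'" by (metis div_mod_decomp)
  qed
  \<comment> \<open>At level \<open>2 * k\<close> both branches of \<open>w\<close> agree, as that
    level is even and \<open>q 0\<close> is the identity.\<close>
  have router: "w i (Suc j) = q (Suc j - 2 * k) (x i) \<and> w i j = q (j - 2 * k) (x i)"
    if "2 * k \<le> j" "i < R" for i j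
    using that q(3) xN by (auto simp: w_def)
  have arc: "(v t, v (Suc t)) \<in> net_arcs K e k" if t: "Suc t < R * L" for t
  proof -
    define i j where "i = t div L" and "j = t mod L"
    have tij: "t = i * L + j" and j: "j < L" using L by (auto simp: i_def j_def)
    have i: "i < R" using bounds[of t] t by (simp add: i_def)
    have group: "agree_outside (bit_group e (level_group k j)) (w i j) (w i (Suc j))"
      if "Suc j < L \<or> 2 * k \<le> j"
    proof (cases "j < 2 * k")
      case True
      then show ?thesis using agree[OF i] by (auto simp: w_def level_group_def intro: agree_outside_sym)
    next
      case False
      then show ?thesis
        using router[of j i] i q(5)[of "j - 2 * k" "x i"] xN[OF i] j
        by (auto simp: level_group_def L_def Suc_diff_le)
    qed
    show ?thesis
    proof (cases "Suc j < L")
      case True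
      then have "Suc t = i * L + Suc j" using tij by simp
      then have "v (Suc t) = net_vertex K (w i (Suc j)) (Suc j mod (4 * k))"
        using v[OF True] True by (simp add: L_def)
      moreover have "v t = net_vertex K (w i j) j" using v[OF j] tij by simp
      ultimately show ?thesis
        using net_arcsI[of j k "w i j" K "w i (Suc j)" e] group True j wN[OF i] by (simp add: L_def)
    next
      case False
      then have Sj: "Suc j = L" using j by simp
      then have St: "Suc t = Suc i * L + 0" using tij by simp
      have "Suc i * L < R * L" using t unfolding St by simp
      then have Si: "Suc i < R" using mult_less_cancel2[of "Suc i" L R] by blast
      have j2: "2 * k \<le> j" using Sj k by (simp add: L_def)
      have "Suc j - 2 * k = 2 * k" using Sj by (simp add: L_def)
      then have "w i (Suc j) = x (Suc i)"
        using router[OF j2 i] q(4)[OF xN[OF i]] \<pi>(2)[OF Si] by simp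
      then have "w i (Suc j) = w (Suc i) 0" by (simp add: w_def)
      then have "v (Suc t) = net_vertex K (w i (Suc j)) (Suc j mod (4 * k))"
        using v[OF L, of "Suc i"] Sj unfolding St by (simp add: L_def)
      moreover have "v t = net_vertex K (w i j) j" using v[OF j] tij by simp
      ultimately show ?thesis
        using net_arcsI[of j k "w i j" K "w i (Suc j)" e] group j2 j wN[OF i] by (simp add: L_def)
    qed
  qed
  have "(0, v 0) \<in> net_arcs K e k"
    using xN[OF R] by (auto simp: v_def w_def net_arcs_def)
  then have "path_arcs 0 v (R * L - 1) \<subseteq> net_arcs K e k"
    using arc by (auto simp: path_arcs_def less_diff_conv)
  moreover have "0 \<notin> v ` {..R * L - 1}" by (auto simp: v_def net_vertex_def)
  ultimately have "path_from (net_arcs K e k) 0 v (R * L - 1)" using inj by (simp add: path_from_def)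
  moreover have "(v (i * L + j), v (Suc (i * L + j))) = bank_arc K j (x i, y i)" if "i < R" "j < 2 * k" for i j
  proof -
    have "v (Suc (i * L + j)) = v (i * L + Suc j)" by simp
    also have "\<dots> = net_vertex K (w i (Suc j)) (Suc j)" using that by (intro v) (simp add: L_def)
    finally show ?thesis
      using v[of j i] that by (auto simp: L_def bank_arc_def w_def)
  qed
  ultimately show ?thesis unfolding L_def by blast
qed

lemma path_from_mono: "path_from E s v r \<Longrightarrow> E \<subseteq> E' \<Longrightarrow> path_from E' s v r"
  by (auto simp: path_from_def)

text \<open>Pass \<open>i\<close> uses a bank arc missing from the \<open>i\<close>-th block of \<open>B\<close> relaxations, so by induction it
  cannot end before that block does.\<close>

lemma universal_sequence_length:
  assumes e: "e \<le> K" and k: "0 < k" "K \<le> k * e" and K: "2 \<le> K"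
    and \<tau>: "\<And>v r. path_from (net_arcs K e k) 0 v r \<Longrightarrow> arcs_embed v r \<tau>"
  shows "2 ^ (K - 2) * (k * (2 ^ K * 2 ^ e)) \<le> length \<tau>"
proof -
  define R where "R = (2 ^ (K - 2) :: nat)"
  \<comment> \<open>Half of the \<open>2 * k * (2 ^ K * 2 ^ e)\<close> bank arcs that are guaranteed
    to exist, as \<open>escaping_pairs\<close> demands of each block; \<open>R\<close> is a quarter
    of the rows for the same lemma.\<close>
  define B where "B = k * (2 ^ K * 2 ^ e :: nat)"
  define L where "L = 4 * k"
  define S where "S i = set (take B (drop (i * B) \<tau>))" for i
  have R0: "0 < R" by (simp add: R_def)
  have R4: "4 * R \<le> 2 ^ K" using power_add[of "2::nat" 2 "K - 2"] unfolding le_add_diff_inverse[OF K] R_def by simp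
  have "card (S i) \<le> B" for i
    unfolding S_def by (rule order_trans[OF card_length]) simp
  then have S: "finite (S i) \<and> 2 * card (S i) \<le> 2 * k * (2 ^ K * 2 ^ e)" for i
    by (auto simp: S_def B_def)
  obtain x y where xy: "inj_on x {..<R}" "inj_on y {..<R}"
    "\<And>i. i < R \<Longrightarrow> (x i, y i) \<in> block_pairs K e \<and> (\<exists>j<2 * k. bank_arc K j (x i, y i) \<notin> S i)"
    using escaping_pairs[where S = S, OF e R4 _ inj_on_bank_arc S] k by auto
  obtain v where v: "path_from (net_arcs K e k) 0 v (R * L - 1)"
    "\<And>i j. i < R \<Longrightarrow> j < 2 * k \<Longrightarrow> (v (i * L + j), v (Suc (i * L + j))) = bank_arc K j (x i, y i)"
    using net_path[OF k R0 xy(1,2)] xy(3) unfolding L_def by blast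
  obtain h where h: "strict_mono_on {..<R * L - 1} h"
    "\<And>a. a < R * L - 1 \<Longrightarrow> h a < length \<tau> \<and> \<tau> ! h a = (v a, v (Suc a))"
    using \<tau>[OF v(1)] unfolding arcs_embed_def by blast
  \<comment> \<open>Bank arcs come early in a pass, so \<open>a\<close> stays below
    \<open>Suc i * L - 1\<close> and is a valid arc index even in the last pass, which has no arc
    closing it.\<close>
  have pass: "\<exists>a<Suc i * L - 1. Suc i * B \<le> h a" if i: "i < R" and start: "i * B \<le> h (i * L)" for i
  proof -
    obtain j where j: "j < 2 * k" "bank_arc K j (x i, y i) \<notin> S i" using xy(3)[OF i] by blast
    define a where "a = i * L + j"
    have a: "a < Suc i * L - 1" using j k by (simp add: a_def L_def)
    have "Suc i * L \<le> R * L" using i by (intro mult_le_mono1) simp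
    then have aR: "a < R * L - 1" using a by linarith
    have "h (i * L) \<le> h a"
      using strict_mono_on_imp_mono_on[OF h(1)] aR by (auto simp: mono_on_def a_def)
    then have ge: "i * B \<le> h a" using start by simp
    \<comment> \<open>Otherwise position \<open>h a\<close> would lie in block \<open>i\<close>, and
      the escaping arc would belong to \<open>S i\<close>.\<close>
    have "\<not> h a < i * B + B"
    proof
      assume less: "h a < i * B + B"
      have "\<tau> ! h a = take B (drop (i * B) \<tau>) ! (h a - i * B)"
        using ge less h(2)[OF aR] by simp
      also have "\<dots> \<in> S i" unfolding S_def using ge less h(2)[OF aR] by (intro nth_mem) auto
      finally show False using j(2) h(2)[OF aR] v(2)[OF i j(1)] by (simp add: a_def)
    qed
    then show ?thesis using a by (intro exI[of _ a]) simp
  qed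
  have start: "i * B \<le> h (i * L)" if "i < R" for i
    using that
  proof (induction i)
    case (Suc i)
    obtain a where a: "a < Suc i * L - 1" "Suc i * B \<le> h a" using pass[of i] Suc by auto
    have "Suc (Suc i) * L \<le> R * L" using Suc.prems by (intro mult_le_mono1) simp
    then have "Suc i * L < R * L - 1" using k by (simp add: L_def)
    moreover have "a \<le> Suc i * L" using a(1) by linarith
    ultimately have "h a \<le> h (Suc i * L)"
      by (intro mono_onD[OF strict_mono_on_imp_mono_on[OF h(1)]]) auto
    then show ?case using a(2) by linarith
  qed simp
  have "R - 1 < R" "Suc (R - 1) = R" using R0 by auto
  then obtain a where "a < R * L - 1" "R * B \<le> h a" using pass[of "R - 1"] start[of "R - 1"] by metis
  then show ?thesis using h(2)[of a] by (simp add: R_def B_def)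
qed

section \<open>Choice of the parameters\<close>

lemma digraph_with_arcs:
  fixes E :: "(nat \<times> nat) set"
  assumes "card E \<le> m" "m \<le> n * (n - 1)" "\<And>u v. (u, v) \<in> E \<Longrightarrow> u \<noteq> v \<and> u < n \<and> v < n"
  shows "\<exists>G. pair_digraph G \<and> pverts G = {..<n} \<and> card (parcs G) = m \<and> E \<subseteq> parcs G"
proof -
  define U where "U = (SIGMA u:{..<n}. {..<n} - {u})"
  have "card U = (\<Sum>u\<in>{..<n}. card ({..<n} - {u}))" unfolding U_def by (intro card_SigmaI) auto
  also have "\<dots> = n * (n - 1)" by simp
  finally have U: "card U = n * (n - 1)" .
  have "E \<subseteq> U" using assms(3) by (auto simp: U_def)
  then obtain B where B: "E \<subseteq> B" "B \<subseteq> U" "card B = m"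
    using exists_subset_between[of E m U] assms(1,2) U by (auto simp: U_def)
  then have "finite B" using finite_subset[of B U] by (auto simp: U_def)
  then have "pair_digraph \<lparr>pverts = {..<n}, parcs = B\<rparr>"
    using B(2) by unfold_locales (auto simp: U_def)
  then show ?thesis using B by (intro exI[of _ "\<lparr>pverts = {..<n}, parcs = B\<rparr>"]) auto
qed

text \<open>For the finitely many small \<open>n\<close>: on the path \<open>0, 1, 2\<close> the arc
  from \<open>1\<close> to \<open>2\<close> has to be relaxed at least once.\<close>

lemma digraph_time_ge_1:
  assumes "3 \<le> n" "n \<le> m" "m \<le> n * (n - 1)"
  shows "\<exists>(G :: nat pair_pre_digraph) s. pair_digraph G \<and> card (pverts G) = n \<and> card (parcs G) = m \<and>
    s \<in> pverts G \<and> (\<forall>A. correct_algorithm G s A \<longrightarrow> 1 \<le> worst_case_time G s A)"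
proof -
  let ?E = "{(0, 1), (1, 2)} :: (nat \<times> nat) set"
  have "card ?E \<le> m" "\<And>u v. (u, v) \<in> ?E \<Longrightarrow> u \<noteq> v \<and> u < n \<and> v < n" using assms by auto
  then obtain G where G: "pair_digraph G" "pverts G = {..<n}" "card (parcs G) = m" "?E \<subseteq> parcs G"
    using digraph_with_arcs[OF _ assms(3), of ?E] by meson
  have path: "path_from (parcs G) 0 Suc 1"
    using G(4) by (auto simp: path_from_def path_arcs_def numeral_2_eq_2)
  have "1 \<le> worst_case_time G 0 A" if A: "correct_algorithm G 0 A" for A
  proof -
    obtain \<tau> where "length \<tau> \<le> worst_case_time G 0 A" "arcs_embed Suc 1 \<tau>"
      using worst_case_relaxation_sequence[OF G(1) A] path by blast
    then show ?thesis by (auto simp: arcs_embed_def)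
  qed
  then show ?thesis using G assms(1) by (intro exI[of _ G] exI[of _ 0]) auto
qed

lemma network_digraph:
  assumes e: "e \<le> K" and k: "0 < k" "K \<le> k * e" and K: "2 \<le> K"
    and n: "1 + 4 * k * 2 ^ K \<le> n" and m: "2 ^ K + 4 * k * (2 ^ K * 2 ^ e) \<le> m" "m \<le> n * (n - 1)"
  shows "\<exists>(G :: nat pair_pre_digraph) s. pair_digraph G \<and> card (pverts G) = n \<and> card (parcs G) = m \<and>
    s \<in> pverts G \<and> (\<forall>A. correct_algorithm G s A \<longrightarrow>
      2 ^ (K - 2) * (k * (2 ^ K * 2 ^ e)) \<le> worst_case_time G s A)"
proof -
  obtain G where G: "pair_digraph G" "pverts G = {..<n}" "card (parcs G) = m" "net_arcs K e k \<subseteq> parcs G"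
    using digraph_with_arcs[of "net_arcs K e k" m n] net_arcs_properties(1)[OF k(1), of K e]
      net_arcs_properties(2)[OF k(1), of _ _ K e] n m
    by (meson order_less_le_trans order_trans)
  have "2 ^ (K - 2) * (k * (2 ^ K * 2 ^ e)) \<le> worst_case_time G 0 A" if A: "correct_algorithm G 0 A" for A
  proof -
    obtain \<tau> where \<tau>: "length \<tau> \<le> worst_case_time G 0 A"
      "\<And>v r. path_from (parcs G) 0 v r \<Longrightarrow> arcs_embed v r \<tau>"
      using worst_case_relaxation_sequence[OF G(1) A] by blast
    have "2 ^ (K - 2) * (k * (2 ^ K * 2 ^ e)) \<le> length \<tau>"
      using path_from_mono[OF _ G(4)] \<tau>(2) by (intro universal_sequence_length[OF e k K]) blast
    then show ?thesis using \<tau>(1) by linarith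
  qed
  then show ?thesis using G n by (intro exI[of _ G] exI[of _ 0]) auto
qed

text \<open>The least suitable \<open>e\<close> makes \<open>2 ^ e\<close> of order
  \<open>m / n\<close>; then the largest \<open>K\<close> for which the network still fits into
  \<open>n\<close> vertices is taken.\<close>

lemma network_parameters:
  fixes n m :: nat
  assumes n: "120 \<le> n" and nm: "n \<le> m" and m: "m \<le> n * (n - 1)"
  shows "\<exists>e K k. 1 \<le> e \<and> e \<le> K \<and> 2 \<le> K \<and> 0 < k \<and> K \<le> k * e \<and> k * e \<le> 2 * K \<and>
    10 * (k * 2 ^ K) \<le> n \<and> n \<le> 40 * (k * 2 ^ K) \<and> n * 2 ^ e \<le> 2 * m \<and> m \<le> 64 * (n * 2 ^ e)"
proof -
  define P where "P e \<longleftrightarrow> 1 \<le> e \<and> m < 64 * (n * 2 ^ e)" for e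
  have "m < 2 ^ Suc m" by (rule less_trans[OF lessI less_exp])
  also have "\<dots> \<le> 64 * (n * 2 ^ Suc m)" using n by simp
  finally have "P (Suc m)" by (simp add: P_def)
  define e where "e = (LEAST e. P e)"
  have e: "1 \<le> e" "m < 64 * (n * 2 ^ e)" using LeastI[of P, OF \<open>P (Suc m)\<close>] by (simp_all add: P_def e_def)
  have e_min: "32 * (n * 2 ^ e) \<le> m" if "e \<noteq> 1"
  proof -
    have "\<not> P (e - 1)" using e(1) by (auto simp: e_def intro!: not_less_Least)
    moreover obtain e' where e': "e = Suc e'" using e(1) by (cases e) auto
    moreover have "1 \<le> e'" using that e' by simp
    ultimately show ?thesis by (auto simp: P_def)
  qed
  define K0 where "K0 = max e 2"
  define Q where "Q K \<longleftrightarrow> 10 * ((K div e + 1) * 2 ^ K) \<le> n" for K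
  \<comment> \<open>For \<open>e = 1\<close> this reads \<open>10 * (3 * 4) <= n\<close>, whence the
    threshold 120. For larger \<open>e\<close>, minimality gives \<open>32 * 2 ^ e <= n - 1\<close>,
    more than the required \<open>20 * 2 ^ e\<close>.\<close>
  have Q0: "Q K0"
  proof (cases "e = 1")
    case True
    then show ?thesis using n by (simp add: Q_def K0_def)
  next
    case False
    then have K0: "K0 = e" using e(1) by (simp add: K0_def)
    have "n * (32 * 2 ^ e) \<le> n * (n - 1)" using e_min[OF False] m unfolding mult.left_commute[of n 32] by linarith
    then have "32 * 2 ^ e \<le> n - 1" using n nat_mult_le_cancel1[of n] by auto
    then show ?thesis using e(1) by (simp add: Q_def K0)
  qed
  have Q_less: "K < n" if "Q K" for K
  proof -
    have "K < 2 ^ K" by (rule less_exp)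
    also have "\<dots> \<le> 10 * ((K div e + 1) * 2 ^ K)" by simp
    finally show ?thesis using that by (simp add: Q_def)
  qed
  define K where "K = Max {K. Q K}"
  have "{K. Q K} \<subseteq> {..<n}" using Q_less by blast
  then have fin: "finite {K. Q K}" by (rule finite_subset) simp
  have QK: "Q K" using Max_in[OF fin] Q0 unfolding K_def by blast
  have K0: "K0 \<le> K" using Max_ge[OF fin, of K0] Q0 by (simp add: K_def)
  have nQ: "\<not> Q (Suc K)" using Max_ge[OF fin, of "Suc K"] unfolding K_def[symmetric] by fastforce
  define k where "k = K div e + 1"
  have eK: "e \<le> K" "2 \<le> K" using K0 by (auto simp: K0_def)
  have Kke: "K \<le> k * e" using dividend_less_times_div[of e K] e(1) by (simp add: k_def algebra_simps)
  have "k * e = K div e * e + e" by (simp add: k_def)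
  then have ke: "k * e \<le> 2 * K" using eK div_times_less_eq_dividend[of K e] by linarith
  \<comment> \<open>Passing to \<open>Suc K\<close> at most doubles both factors, so maximality of
    \<open>K\<close> bounds \<open>n\<close> by \<open>4 * 10\<close> times
    \<open>k * 2 ^ K\<close>.\<close>
  have "Suc K div e + 1 \<le> 2 * k" using e(1) by (simp add: k_def div_Suc)
  then have "(Suc K div e + 1) * 2 ^ Suc K \<le> 2 * k * 2 ^ Suc K" by (rule mult_le_mono1)
  then have "n \<le> 40 * (k * 2 ^ K)" using nQ by (simp add: Q_def)
  moreover have "10 * (k * 2 ^ K) \<le> n" using QK by (simp add: Q_def k_def)
  moreover have "n * 2 ^ e \<le> 2 * m" using e_min nm by (cases "e = 1") auto
  ultimately show ?thesis using e eK Kke ke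
    by (intro exI[of _ e] exI[of _ K] exI[of _ k]) (auto simp: k_def)
qed

text \<open>The factor \<open>k\<close> is the loss against \<open>n * m\<close>. As
  \<open>k * e <= 2 * K\<close> and \<open>2 ^ K <= n\<close>, it is logarithmic in \<open>n\<close>
  at worst, and bounded when \<open>e\<close> is of order \<open>log n\<close>.\<close>

lemma network_time:
  fixes n m :: nat
  assumes n: "120 \<le> n" and nm: "n \<le> m" and m: "m \<le> n * (n - 1)"
  shows "\<exists>(G :: nat pair_pre_digraph) s e K k. pair_digraph G \<and> card (pverts G) = n \<and> card (parcs G) = m \<and>
    s \<in> pverts G \<and> 1 \<le> e \<and> k * e \<le> 2 * K \<and> 2 ^ K \<le> n \<and> m \<le> 64 * (n * 2 ^ e) \<and>
    (\<forall>A. correct_algorithm G s A \<longrightarrow> n * m \<le> 409600 * (k * worst_case_time G s A))"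
proof -
  obtain e K k where p: "1 \<le> e" "e \<le> K" "2 \<le> K" "0 < k" "K \<le> k * e" "k * e \<le> 2 * K"
    "10 * (k * 2 ^ K) \<le> n" "n \<le> 40 * (k * 2 ^ K)" "n * 2 ^ e \<le> 2 * m" "m \<le> 64 * (n * 2 ^ e)"
    using network_parameters[OF assms] by blast
  let ?N = "2 ^ K :: nat" and ?d = "2 ^ e :: nat"
  have kN: "1 \<le> k * ?N" "?N \<le> k * ?N" using p(4) by auto
  have n4: "1 + 4 * k * ?N \<le> n" using p(7) kN unfolding mult.assoc by linarith
  have "10 * (k * ?N) * ?d \<le> n * ?d" using p(7) by (rule mult_le_mono1)
  then have "5 * (k * (?N * ?d)) \<le> m" using p(9) unfolding mult.assoc by linarith
  moreover have "?N \<le> k * (?N * ?d)" using kN(2) mult_le_mono[of ?N "k * ?N" 1 ?d] by (simp add: mult.assoc)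
  ultimately have m4: "?N + 4 * k * (?N * ?d) \<le> m" unfolding mult.assoc by linarith
  obtain G :: "nat pair_pre_digraph" and s where G: "pair_digraph G" "card (pverts G) = n" "card (parcs G) = m" "s \<in> pverts G"
    "\<And>A. correct_algorithm G s A \<Longrightarrow> 2 ^ (K - 2) * (k * (?N * ?d)) \<le> worst_case_time G s A"
    using network_digraph[OF p(2,4,5,3) n4 m4 m] by blast
  have N4: "4 * 2 ^ (K - 2) = ?N"
    using power_add[of "2::nat" 2 "K - 2"] unfolding le_add_diff_inverse[OF p(3)] by simp
  have time: "n * m \<le> 409600 * (k * worst_case_time G s A)" if A: "correct_algorithm G s A" for A
  proof -
    \<comment> \<open>The extra factor \<open>n\<close> cancels against the one in the bound on
      \<open>m\<close>. The constant is \<open>40 * 40 * 64\<close>, times 4 for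
      \<open>2 ^ K = 4 * 2 ^ (K - 2)\<close>.\<close>
    have "n * (n * m) = (n * n) * m" by simp
    also have "\<dots> \<le> ((40 * (k * ?N)) * (40 * (k * ?N))) * (64 * (n * ?d))"
      using p(8,10) by (intro mult_le_mono)
    also have "\<dots> = n * (102400 * (k * (?N * (k * (?N * ?d)))))" by (simp add: algebra_simps)
    also have "\<dots> = n * (409600 * (k * (2 ^ (K - 2) * (k * (?N * ?d)))))"
      by (subst (1) N4[symmetric]) (simp add: algebra_simps)
    also have "\<dots> \<le> n * (409600 * (k * worst_case_time G s A))"
      using G(5)[OF A] by (intro mult_le_mono2)
    finally show ?thesis using n by simp
  qed
  have "?N \<le> n" using kN(2) p(7) by linarith
  then show ?thesis using G(1-4) p time by blast
qed

theorem theorem4: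
  "\<exists>(c :: real) (c' :: real \<Rightarrow> real \<Rightarrow> real).
     c > 0 \<and> (\<forall>\<epsilon>>0. \<forall>a>0. c' \<epsilon> a > 0) \<and>
     (\<forall>(n :: nat) (m :: nat). 3 \<le> n \<and> n \<le> m \<and> m \<le> n * (n - 1) \<longrightarrow>
       (\<exists>(G :: nat pair_pre_digraph) (s :: nat).
          pair_digraph G \<and> card (pverts G) = n \<and> card (parcs G) = m \<and> s \<in> pverts G \<and>
          (\<forall>A. correct_algorithm G s A \<longrightarrow>
             c * (real n * real m / ln (real n)) \<le> real (worst_case_time G s A) \<and>
             (\<forall>\<epsilon>>0. \<forall>a>0. a * real n powr (1 + \<epsilon>) \<le> real m \<longrightarrow>
                c' \<epsilon> a * (real n * real m) \<le> real (worst_case_time G s A)))))"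
proof -
  \<comment> \<open>This is \<open>1 / (4 * 500000)\<close>, where 500000 exceeds 409600 and 4 comes
    from \<open>k <= 4 * ln n\<close>; it is also below \<open>1 / 120^3\<close>, which settles
    \<open>n < 120\<close> with a single step.\<close>
  define c :: real where "c = 1 / 2000000"
  \<comment> \<open>The second term comes from
    \<open>k <= 4 * (7 + \<bar>ln a\<bar>) / \<epsilon>\<close> in the dense case; the minimum with
    1 serves the small \<open>n\<close>.\<close>
  define c' :: "real \<Rightarrow> real \<Rightarrow> real" where "c' \<epsilon> a = c * min 1 (\<epsilon> / (7 + \<bar>ln a\<bar>))" for \<epsilon> a
  have c0: "0 \<le> c" by (simp add: c_def)
  have c'_le: "c' \<epsilon> a \<le> c * 1" "c' \<epsilon> a \<le> c * (\<epsilon> / (7 + \<bar>ln a\<bar>))" for \<epsilon> a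
    unfolding c'_def by (rule mult_left_mono[OF min.cobounded1 c0], rule mult_left_mono[OF min.cobounded2 c0])
  have "\<exists>(G :: nat pair_pre_digraph) (s :: nat).
          pair_digraph G \<and> card (pverts G) = n \<and> card (parcs G) = m \<and> s \<in> pverts G \<and>
          (\<forall>A. correct_algorithm G s A \<longrightarrow>
             c * (real n * real m / ln (real n)) \<le> real (worst_case_time G s A) \<and>
             (\<forall>\<epsilon>>0. \<forall>a>0. a * real n powr (1 + \<epsilon>) \<le> real m \<longrightarrow>
                c' \<epsilon> a * (real n * real m) \<le> real (worst_case_time G s A)))"
    if n: "3 \<le> n" and nm: "n \<le> m" and m: "m \<le> n * (n - 1)" for n m :: nat
  proof -
    have "exp 1 \<le> real n" using exp_le n by linarith
    then have ln1: "1 \<le> ln (real n)" using n by (simp add: ln_ge_iff)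
    show ?thesis
    proof (cases "n < 120")
      case True
      obtain G :: "nat pair_pre_digraph" and s where G: "pair_digraph G" "card (pverts G) = n" "card (parcs G) = m" "s \<in> pverts G"
        "\<And>A. correct_algorithm G s A \<Longrightarrow> 1 \<le> worst_case_time G s A"
        using digraph_time_ge_1[OF n nm m] by blast
      have "n * (n - 1) \<le> 120 * 120" using True by (intro mult_le_mono) auto
      then have "n * m \<le> 120 * (120 * 120)" using True m by (intro mult_le_mono) linarith+
      then have "real (n * m) \<le> real (120 * (120 * 120))" by (simp only: of_nat_le_iff)
      then have nm_le: "c * (real n * real m) \<le> 1" by (simp add: c_def)
      have first: "c * (real n * real m / ln (real n)) \<le> 1"
      proof -
        have "real n * real m / ln (real n) \<le> real n * real m / 1"
          using ln1 by (intro divide_left_mono) auto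
        then have "c * (real n * real m / ln (real n)) \<le> c * (real n * real m)"
          by (simp add: c_def)
        then show ?thesis using nm_le by linarith
      qed
      have second: "c' \<epsilon> a * (real n * real m) \<le> 1" for \<epsilon> a
        using mult_right_mono[OF c'_le(1)[of \<epsilon> a], of "real n * real m"] nm_le by simp
      show ?thesis
        using G first second
        by (intro exI[of _ G] exI[of _ s]) (fastforce intro: order_trans)
    next
      case False
      then have n120: "120 \<le> n" by simp
      obtain G :: "nat pair_pre_digraph" and s e K k where G: "pair_digraph G" "card (pverts G) = n" "card (parcs G) = m" "s \<in> pverts G"
        "1 \<le> e" "k * e \<le> 2 * K" "2 ^ K \<le> n" "m \<le> 64 * (n * 2 ^ e)"
        and time: "\<And>A. correct_algorithm G s A \<Longrightarrow> n * m \<le> 409600 * (k * worst_case_time G s A)"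
        using network_time[OF n120 nm m] by blast
      define x where "x = ln (real n)"
      have x1: "1 \<le> x" using ln1 by (simp add: x_def)
      have "ln (2 ^ K :: real) \<le> x"
        unfolding x_def using G(7) n by (subst ln_le_cancel_iff) (auto simp: numeral_power_le_of_nat_cancel_iff)
      then have "real K * ln 2 \<le> x" by (simp add: ln_realpow)
      moreover have "real K * (1 / 2) \<le> real K * ln 2"
        using ln2_ge_two_thirds by (intro mult_left_mono) auto
      ultimately have "real K \<le> 2 * x" by linarith
      moreover have "real k * real e \<le> 2 * real K"
        using G(6) by (metis of_nat_le_iff of_nat_mult of_nat_numeral)
      ultimately have ke: "real k * real e \<le> 4 * x" by linarith
      have e1: "1 \<le> real e" using G(5) by simp
      have "real k * 1 \<le> real k * real e" using e1 by (intro mult_left_mono) auto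
      then have kx: "real k \<le> 4 * x" using ke by linarith
      have T: "c * (real n * real m) \<le> real k / 4 * real (worst_case_time G s A)"
        if "correct_algorithm G s A" for A
      proof -
        have "real (n * m) \<le> real (409600 * (k * worst_case_time G s A))"
          using time[OF that] by (simp only: of_nat_le_iff)
        moreover have "0 \<le> real k * real (worst_case_time G s A)" by simp
        ultimately have "real n * real m \<le> 500000 * (real k * real (worst_case_time G s A))"
          unfolding of_nat_mult of_nat_numeral by linarith
        then show ?thesis unfolding c_def by linarith
      qed
      have first: "c * (real n * real m / ln (real n)) \<le> real (worst_case_time G s A)"
        if A: "correct_algorithm G s A" for A
      proof -
        have "real k / 4 * real (worst_case_time G s A) \<le> x * real (worst_case_time G s A)"
          using kx by (intro mult_right_mono) auto
        then have "c * (real n * real m) \<le> x * real (worst_case_time G s A)" using T[OF A] by linarith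
        then show ?thesis using x1 by (simp add: x_def[symmetric] field_simps)
      qed
      have second: "c' \<epsilon> a * (real n * real m) \<le> real (worst_case_time G s A)"
        if A: "correct_algorithm G s A" and \<epsilon>: "0 < \<epsilon>" and a: "0 < a"
          and am: "a * real n powr (1 + \<epsilon>) \<le> real m" for A \<epsilon> a
      proof -
        define y where "y = 7 + \<bar>ln a\<bar>"
        define W where "W = real (worst_case_time G s A)"
        have y: "0 < y" by (simp add: y_def)
        \<comment> \<open>Density forces \<open>2 ^ e\<close> to be at least of order
          \<open>n powr \<epsilon>\<close>, so \<open>e\<close> grows like \<open>ln n\<close> and
          \<open>k\<close> stays bounded.\<close>
        have "real n * (a * real n powr \<epsilon>) = a * real n powr (1 + \<epsilon>)"
          using n by (simp add: powr_add)
        also have "\<dots> \<le> real (64 * (n * 2 ^ e))" using am G(8) by (metis of_nat_le_iff order_trans)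
        also have "\<dots> = real n * (2 ^ (6 + e))" by (simp add: power_add)
        finally have "a * real n powr \<epsilon> \<le> 2 ^ (6 + e)" using n by simp
        then have "ln (a * real n powr \<epsilon>) \<le> ln (2 ^ (6 + e))"
          using a n by (subst ln_le_cancel_iff) auto
        then have "ln a + \<epsilon> * x \<le> real (6 + e) * ln 2"
          using a n by (simp add: ln_mult ln_powr ln_realpow x_def)
        also have "\<dots> \<le> real (6 + e) * 1" using ln_2_less_1 by (intro mult_left_mono) auto
        finally have "\<epsilon> * x \<le> 6 + real e + \<bar>ln a\<bar>" by simp
        \<comment> \<open>The 6 stems from \<open>64 = 2 ^ 6\<close>; since \<open>1 <= e\<close>,
          the additive constants are absorbed into the factor \<open>y\<close>.\<close>
        also have "\<dots> \<le> real e * y"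
        proof -
          have "1 * (6 + \<bar>ln a\<bar>) \<le> real e * (6 + \<bar>ln a\<bar>)" using e1 by (intro mult_right_mono) auto
          then show ?thesis by (simp add: y_def algebra_simps)
        qed
        finally have ex: "\<epsilon> * x \<le> real e * y" .
        have "real e * (\<epsilon> * real k) \<le> \<epsilon> * (4 * x)"
          using mult_left_mono[OF ke, of \<epsilon>] \<epsilon> by (simp add: algebra_simps)
        also have "\<dots> \<le> real e * (4 * y)" using ex by (simp add: algebra_simps)
        finally have k4: "\<epsilon> * real k \<le> 4 * y" using e1 by simp
        have "\<epsilon> * (c * (real n * real m)) \<le> \<epsilon> * (real k / 4 * W)"
          using T[OF A] \<epsilon> by (intro mult_left_mono) (auto simp: W_def)
        also have "\<dots> = \<epsilon> * real k / 4 * W" by simp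
        also have "\<dots> \<le> y * W" using k4 by (intro mult_right_mono) (auto simp: W_def)
        finally have "c * (\<epsilon> / y) * (real n * real m) \<le> W" using y by (simp add: field_simps)
        moreover have "c' \<epsilon> a * (real n * real m) \<le> c * (\<epsilon> / y) * (real n * real m)"
          using c'_le(2)[of \<epsilon> a] by (intro mult_right_mono) (auto simp: y_def)
        ultimately show ?thesis by (simp add: W_def)
      qed
      show ?thesis using G(1-4) first second by (intro exI[of _ G] exI[of _ s]) auto
    qed
  qed
  moreover have "0 < c" "\<forall>\<epsilon>>0. \<forall>a>0. 0 < c' \<epsilon> a"
    by (auto simp: c_def c'_def intro!: divide_pos_pos add_pos_nonneg)
  ultimately show ?thesis by (intro exI[of _ c] exI[of _ c']) auto
qed

end
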